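(* Let $S$ be the symmetric Bernoulli random walk and, for $t>0$ and $x\in\mathbb{R}$, let $V^S(t,x)=\sup_\tau \mathbb{E}\left[\frac{x+S_\tau}{t+\tau}\right]$. For $0<c$ let $$h_c(t,x):=K\int_0^\infty e^{ax-\frac{c}{2}a^2t}\,da=K\,\frac{1}{ct}\,\frac{\Phi_{ct}(x)}{\varphi_{ct}(x)},\qquad K=K(c)=\alpha c\,\frac{\varphi_c(\alpha)}{\Phi_c(\alpha)}.$$ Given a time horizon $T>0$, let $c_1$ be the biggest solution $c$ smaller than $1$ of $$\frac12\left(h_c(T+1,\alpha\sqrt{T}-1)+h_c(T+1,\alpha\sqrt{T}+1)\right)=h_c(T,\alpha\sqrt{T}),$$ let $c_2$ be the unique positive solution $c$ of $$h_c(T,\alpha\sqrt{T}-1)=\frac{\alpha\sqrt{T}-1}{T},$$ and let $c=\min\{c_1,c_2\}$. Let $a_0$ be the unique positive solution (in $a$) of $$\frac12\left(e^{a}+e^{-a}\right)e^{-\frac{c}{2}a^2}=1.$$ If $$T\ge\left(\frac{\alpha}{a_0c}\right)^2,$$ then $h_c(t,x)$ is a lower bound for $V^S(t,x)$, i.e. $h_c(t,x)\le V^S(t,x)$, for all $t\ge T$ and all $x\le\alpha\sqrt{t}$.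
   Context: The symmetric Bernoulli random walk is $S_n=\sum_{i=1}^n X_i$, $S_0=0$, with $X_i$ i.i.d. and $P(X_i=1)=P(X_i=-1)=\frac12$. The supremum defining $V^S$ is over all a.s. finite stopping times $\tau$ with values in $\{0,1,2,\dots\}$ with respect to the natural filtration of $S$. For $s>0$, $\Phi_s(x)=\Phi(x/\sqrt{s})$ and $\varphi_s$ denote the cumulative distribution function and the density of the centered normal distribution with variance $s$; $\Phi=\Phi_1$, $\varphi=\varphi_1$. The constant $\alpha\approx 0.839923675692373$ is the unique solution of $\alpha\varphi(\alpha)=(1-\alpha^2)\Phi(\alpha)$. Solutions $c$ are understood to be positive real numbers (so that $h_c$ is defined), and the constant $K=K(c)$ depends on $c$ in the equations determining $c_1$ and $c_2$. *)

theory Defs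
  imports "HOL-Probability.Probability"
begin

text \<open>The parameter \<open>s\<close> is the variance; the second argument of \<^const>\<open>normal_density\<close> is the
  standard deviation.\<close>

definition norm_cdf :: "real \<Rightarrow> real \<Rightarrow> real" where
  "norm_cdf s x = cdf (density lborel (normal_density 0 (sqrt s))) x"

definition norm_pdf :: "real \<Rightarrow> real \<Rightarrow> real" where
  "norm_pdf s x = normal_density 0 (sqrt s) x"

definition alpha :: real where
  "alpha = (THE a. a * norm_pdf 1 a = (1 - a\<^sup>2) * norm_cdf 1 a)"

definition K_const :: "real \<Rightarrow> real" where
  "K_const c = alpha * c * (norm_pdf c alpha / norm_cdf c alpha)"

definition h :: "real \<Rightarrow> real \<Rightarrow> real \<Rightarrow> real" where
  "h c t x = K_const c * (LBINT a:{0..}. exp (a * x - c / 2 * a\<^sup>2 * t))"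

lemma norm_cdf_eq_LBINT:
  assumes "s > 0"
  shows "norm_cdf s x = (LBINT y:{..x}. norm_pdf s y)"
proof -
  have "norm_cdf s x = (LINT y|density lborel (normal_density 0 (sqrt s)). indicator {..x} y)"
    by (simp add: norm_cdf_def cdf_def)
  also have "\<dots> = (LBINT y. normal_density 0 (sqrt s) y *\<^sub>R indicator {..x} y)"
    by (subst integral_density) auto
  finally show ?thesis
    by (simp add: set_lebesgue_integral_def norm_pdf_def mult.commute)
qed

lemma norm_cdf_scale:
  assumes "s > 0"
  shows "norm_cdf s x = norm_cdf 1 (x / sqrt s)"
proof -
  have s: "sqrt s > 0" using assms by simp
  have "norm_cdf s x = (LBINT y. indicator {..x} y *\<^sub>R norm_pdf s y)"
    using assms by (simp add: norm_cdf_eq_LBINT set_lebesgue_integral_def)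
  also have "\<dots> = \<bar>sqrt s\<bar> *\<^sub>R (LBINT y. indicator {..x} (0 + sqrt s * y) *\<^sub>R norm_pdf s (0 + sqrt s * y))"
    by (rule lborel_integral_real_affine) (use assms in auto)
  also have "\<dots> = (LBINT y. indicator {..x / sqrt s} y *\<^sub>R norm_pdf 1 y)"
    unfolding integral_scaleR_right[symmetric]
  proof (rule Bochner_Integration.integral_cong)
    fix y
    have "(sqrt s * y \<le> x) = (y \<le> x / sqrt s)"
      using s by (simp add: field_simps)
    moreover have "sqrt s * norm_pdf s (sqrt s * y) = norm_pdf 1 y"
      using assms by (simp add: norm_pdf_def normal_density_def power_mult_distrib real_sqrt_mult)
    ultimately show "\<bar>sqrt s\<bar> *\<^sub>R indicator {..x} (0 + sqrt s * y) *\<^sub>R norm_pdf s (0 + sqrt s * y)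
        = indicator {..x / sqrt s} y *\<^sub>R norm_pdf 1 y"
      using s by (auto simp: indicator_def)
  qed simp
  finally show ?thesis
    by (simp add: norm_cdf_eq_LBINT set_lebesgue_integral_def)
qed

lemma h_closed_form:
  assumes "c > 0" "t > 0"
  shows "h c t x = K_const c * (1 / (c * t)) * (norm_cdf (c * t) x / norm_pdf (c * t) x)"
proof -
  define s where "s = c * t"
  have s: "s > 0" using assms by (simp add: s_def)
  have p: "norm_pdf s x > 0"
    using s by (simp add: norm_pdf_def normal_density_pos)
  have "norm_cdf s x = (LBINT y. indicator {..x} y *\<^sub>R norm_pdf s y)"
    using s by (simp add: norm_cdf_eq_LBINT set_lebesgue_integral_def)
  also have "\<dots> = \<bar>- s\<bar> *\<^sub>R (LBINT a. indicator {..x} (x + (- s) * a) *\<^sub>R norm_pdf s (x + (- s) * a))"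
    by (rule lborel_integral_real_affine) (use s in auto)
  also have "\<dots> = s * (LBINT a. norm_pdf s x * (indicator {0..} a *\<^sub>R exp (a * x - c / 2 * a\<^sup>2 * t)))"
  proof -
    have "indicator {..x} (x + (- s) * a) *\<^sub>R norm_pdf s (x + (- s) * a)
        = norm_pdf s x * (indicator {0..} a *\<^sub>R exp (a * x - c / 2 * a\<^sup>2 * t))" for a
    proof -
      have "(x + (- s) * a \<le> x) = (0 \<le> a)"
        using s by (simp add: zero_le_mult_iff)
      moreover have "- (x - s * a)\<^sup>2 / (2 * s) = - x\<^sup>2 / (2 * s) + (a * x - s / 2 * a\<^sup>2)"
        using s by (simp add: field_simps power2_eq_square)
      hence "norm_pdf s (x - s * a) = norm_pdf s x * exp (a * x - s / 2 * a\<^sup>2)"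
        using s by (simp add: norm_pdf_def normal_density_def exp_add[symmetric])
      hence "norm_pdf s (x + (- s) * a) = norm_pdf s x * exp (a * x - c / 2 * a\<^sup>2 * t)"
        by (simp add: s_def mult_ac)
      ultimately show ?thesis by (auto simp: indicator_def)
    qed
    thus ?thesis using s by simp
  qed
  also have "\<dots> = s * norm_pdf s x * (LBINT a:{0..}. exp (a * x - c / 2 * a\<^sup>2 * t))"
    by (simp add: set_lebesgue_integral_def)
  finally have "(LBINT a:{0..}. exp (a * x - c / 2 * a\<^sup>2 * t)) = 1 / s * (norm_cdf s x / norm_pdf s x)"
    using s p by (simp add: field_simps)
  thus ?thesis by (simp add: h_def s_def)
qed

definition walk :: "(nat \<Rightarrow> 'a \<Rightarrow> real) \<Rightarrow> nat \<Rightarrow> 'a \<Rightarrow> real" where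
  "walk X n \<omega> = (\<Sum>i=1..n. X i \<omega>)"

text \<open>Stopping times are only almost surely finite, hence \<open>enat\<close>-valued, and the natural
  filtration is indexed by \<open>enat\<close>: at \<open>\<infinity>\<close> it is the \<open>\<sigma>\<close>-algebra generated by the whole walk,
  so the condition of \<^const>\<open>stopping_time\<close> at \<open>\<infinity>\<close> is vacuous.\<close>

definition walk_filtration :: "'a measure \<Rightarrow> (nat \<Rightarrow> 'a \<Rightarrow> real) \<Rightarrow> enat \<Rightarrow> 'a measure" where
  "walk_filtration M X n =
     sigma (space M) {walk X k -` A \<inter> space M | k A. enat k \<le> n \<and> A \<in> sets borel}"

definition stopping_times :: "'a measure \<Rightarrow> (nat \<Rightarrow> 'a \<Rightarrow> real) \<Rightarrow> ('a \<Rightarrow> enat) set" where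
  "stopping_times M X =
     {\<tau>. stopping_time (walk_filtration M X) \<tau> \<and> (AE \<omega> in M. \<tau> \<omega> \<noteq> \<infinity>)}"

text \<open>For \<open>t > 0\<close> and steps bounded by \<open>1\<close> the payoff is bounded by \<open>\<bar>x\<bar> / t + 1\<close>, so the
  expectations exist and the supremum over the real line is a genuine one. The value of the
  payoff on the null set where \<open>\<tau>\<close> is infinite is irrelevant.\<close>

definition value_fun :: "'a measure \<Rightarrow> (nat \<Rightarrow> 'a \<Rightarrow> real) \<Rightarrow> real \<Rightarrow> real \<Rightarrow> real" where
  "value_fun M X t x =
     (SUP \<tau>\<in>stopping_times M X.
        LINT \<omega>|M. (x + walk X (the_enat (\<tau> \<omega>)) \<omega>) / (t + real (the_enat (\<tau> \<omega>))))"

definition symmetric_bernoulli_steps :: "'a measure \<Rightarrow> (nat \<Rightarrow> 'a \<Rightarrow> real) \<Rightarrow> bool" where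
  "symmetric_bernoulli_steps M X \<longleftrightarrow>
     prob_space.indep_vars M (\<lambda>_. borel) X {1..} \<and>
     (\<forall>i\<ge>1. measure M {\<omega> \<in> space M. X i \<omega> = 1} = 1 / 2 \<and>
            measure M {\<omega> \<in> space M. X i \<omega> = - 1} = 1 / 2)"

end

theory Submission
  imports Defs "HOL-Real_Asymp.Real_Asymp"
begin

text \<open>Start at \<open>(t, x)\<close> and stop the walk as soon as \<open>x + S n \<ge> alpha * sqrt (t + n) - 1\<close>. The walk
  then never exceeds \<open>alpha * sqrt (t + n)\<close>, and \<open>h c\<close> along it is a submartingale up to the stopping
  time, where it is at most the payoff. Truncating at \<open>N\<close> costs only \<open>O(1 / sqrt N)\<close>.

  The submartingale property at one point of the boundary is the equation for \<open>c1\<close>. It carries over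
  from \<open>c1\<close> to \<open>c\<close> and from \<open>(T, alpha * sqrt T)\<close> to all later points below the boundary, because the
  integrands change sign only once and the change of weight favours the positive part. The
  comparison with the payoff carries over from \<open>c2\<close> in the same way, and to the interval between
  the two points of equality because \<open>h c\<close> is convex in the scaled variable \<open>y / sqrt s\<close>.\<close>

section \<open>Gaussian functions and the constant alpha\<close>

text \<open>Completing the square turns the integrand into a multiple of the normal density with
  mean \<open>u / c\<close> and variance \<open>1 / c\<close>.\<close>

lemma integrable_exp_quadratic:
  fixes c u :: real
  assumes "c > 0"
  shows "integrable lborel (\<lambda>k. exp (k * u - c / 2 * k\<^sup>2))"
proof -
  have "exp (k * u - c / 2 * k\<^sup>2) =
        exp (u\<^sup>2 / (2 * c)) * sqrt (2 * pi / c) * normal_density (u / c) (1 / sqrt c) k" for k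
  proof -
    have "k * u - c / 2 * k\<^sup>2 = u\<^sup>2 / (2 * c) + (- (k - u / c)\<^sup>2 / (2 / c))"
      using assms by (simp add: field_simps power2_eq_square)
    then have "exp (k * u - c / 2 * k\<^sup>2) = exp (u\<^sup>2 / (2 * c)) * exp (- (k - u / c)\<^sup>2 / (2 / c))"
      by (metis exp_add)
    then show ?thesis
      using assms by (simp add: normal_density_def power_divide real_sqrt_divide)
  qed
  then show ?thesis
    using assms by (simp add: integrable_normal_density)
qed

lemma set_integrable_exp_quadratic:
  fixes c u :: real
  assumes "c > 0"
  shows "set_integrable lborel {0..} (\<lambda>k. exp (k * u - c / 2 * k\<^sup>2))"
  using integrable_exp_quadratic[OF assms]
  by (intro set_integrable_subset[where A = UNIV and B = "{0..}"])
     (simp_all add: set_integrable_def)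

lemma norm_pdf_pos: "s > 0 \<Longrightarrow> norm_pdf s x > 0"
  by (simp add: norm_pdf_def normal_density_pos)

text \<open>The fundamental theorem of calculus is applied on a compact interval, so the cdf is
  split at \<open>b = x - 1\<close>, which makes \<open>x\<close> an interior point of
  \<open>{b..x+1}\<close>.\<close>

lemma norm_cdf_DERIV: "(norm_cdf 1 has_real_derivative norm_pdf 1 x) (at x)"
proof -
  define b where "b = x - 1"
  have int: "set_integrable lborel S (norm_pdf 1)" if "S \<in> sets borel" for S
    using that integrable_normal_density[of 1 0]
    by (intro set_integrable_subset[where A = UNIV and B = S])
       (simp_all add: set_integrable_def norm_pdf_def[abs_def])
  have cont: "continuous_on S (norm_pdf 1)" for S
    unfolding norm_pdf_def[abs_def] normal_density_def by (intro continuous_intros) auto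
  have eq: "norm_cdf 1 y = norm_cdf 1 b + integral {b..y} (norm_pdf 1)" if "y \<in> {b..x+1}" for y
  proof -
    have "norm_cdf 1 y = (LBINT z:{..b} \<union> {b<..y}. norm_pdf 1 z)"
      using that by (simp add: norm_cdf_eq_LBINT ivl_disj_un)
    also have "\<dots> = norm_cdf 1 b + (LBINT z:{b<..y}. norm_pdf 1 z)"
      by (subst set_integral_Un) (auto simp: norm_cdf_eq_LBINT int)
    also have "(LBINT z:{b<..y}. norm_pdf 1 z) = (LBINT z:{b..y}. norm_pdf 1 z)"
      unfolding set_lebesgue_integral_def
      by (intro integral_cong_AE)
        (auto simp: norm_pdf_def[abs_def] indicator_def intro!: eventually_mono[OF AE_lborel_singleton[of b]])
    also have "\<dots> = integral {b..y} (norm_pdf 1)"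
      by (rule set_borel_integral_eq_integral(2)) (simp add: int)
    finally show ?thesis .
  qed
  have "((\<lambda>y. norm_cdf 1 b + integral {b..y} (norm_pdf 1)) has_real_derivative norm_pdf 1 x)
      (at x within {b..x+1})"
    using integral_has_real_derivative[OF cont, of x b "x+1"]
    by (auto intro!: derivative_eq_intros simp: b_def)
  then have "(norm_cdf 1 has_real_derivative norm_pdf 1 x) (at x within {b..x+1})"
    by (rule has_field_derivative_transform_within[OF _ zero_less_one]) (simp_all add: eq[symmetric], simp add: b_def)
  then show ?thesis
    by (simp add: at_within_Icc_at b_def)
qed

lemma norm_cdf_strict_mono:
  assumes "x < y" shows "norm_cdf 1 x < norm_cdf 1 y"
  by (rule DERIV_pos_imp_increasing[OF assms]) (meson norm_cdf_DERIV norm_pdf_pos zero_less_one)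

lemma norm_cdf_1_pos: "norm_cdf 1 x > 0"
proof -
  have "0 \<le> norm_cdf 1 (x - 1)"
    by (simp add: norm_cdf_def cdf_def)
  also have "\<dots> < norm_cdf 1 x"
    by (rule norm_cdf_strict_mono) simp
  finally show ?thesis .
qed

lemma norm_cdf_pos: "s > 0 \<Longrightarrow> norm_cdf s x > 0"
  by (simp add: norm_cdf_scale[of s] norm_cdf_1_pos)

lemma norm_pdf_DERIV: "(norm_pdf 1 has_real_derivative - x * norm_pdf 1 x) (at x)"
proof -
  have "((\<lambda>x. exp (- x\<^sup>2 / 2)) has_real_derivative exp (- x\<^sup>2 / 2) * - x) (at x)"
    by (auto intro!: derivative_eq_intros)
  from DERIV_cmult[OF this, of "1 / sqrt (2 * pi)"]
  moreover have "norm_pdf 1 = (\<lambda>x. 1 / sqrt (2 * pi) * exp (- x\<^sup>2 / 2))"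
    by (simp add: norm_pdf_def fun_eq_iff std_normal_density_def)
  ultimately show ?thesis
    by (simp add: mult_ac)
qed

text \<open>On the negative axis \<open>norm_cdf 1 y + norm_pdf 1 y / y\<close> has derivative
  \<open>- norm_pdf 1 y / (y * y)\<close>. It therefore decreases from its limit 0 at minus infinity
  and is never positive. The bound serves to exclude nonpositive solutions of the equation for
  \<open>alpha\<close>.\<close>

lemma mills_upper_bound:
  assumes "a < 0"
  shows "- a * norm_cdf 1 a \<le> norm_pdf 1 a"
proof -
  define \<xi> where "\<xi> b = norm_cdf 1 b + norm_pdf 1 b / b" for b :: real
  have le: "\<xi> a \<le> \<xi> b" if "b < a" for b
  proof (rule DERIV_nonpos_imp_nonincreasing[of b a])
    fix y assume "b \<le> y" "y \<le> a"
    then have y: "y < 0" using assms by simp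
    have "(\<xi> has_real_derivative (norm_pdf 1 y + ((- y * norm_pdf 1 y) * y - norm_pdf 1 y * 1) / (y * y))) (at y)"
      unfolding \<xi>_def[abs_def]
      by (intro derivative_intros norm_cdf_DERIV norm_pdf_DERIV) (use y in auto)
    moreover have "norm_pdf 1 y + ((- y * norm_pdf 1 y) * y - norm_pdf 1 y * 1) / (y * y)
        = - norm_pdf 1 y / (y * y)"
      using y by (simp add: field_simps)
    ultimately show "\<exists>d. (\<xi> has_real_derivative d) (at y) \<and> d \<le> 0"
      using norm_pdf_pos[of 1 y] y by (intro exI[of _ "- norm_pdf 1 y / (y * y)"] conjI)
        (simp_all only:, simp add: zero_le_divide_iff)
  qed (use that in simp)
  have lim1: "(norm_cdf 1 \<longlongrightarrow> 0) at_bot"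
  proof -
    interpret D: real_distribution "density lborel (normal_density 0 1)"
      by (simp add: real_distribution_def real_distribution_axioms_def prob_space_normal_density)
    show ?thesis
      using D.cdf_lim_at_bot by (simp add: norm_cdf_def[abs_def])
  qed
  have lim2: "((\<lambda>b. norm_pdf 1 b / b) \<longlongrightarrow> 0) at_bot"
  proof (rule Lim_null_comparison)
    show "\<forall>\<^sub>F b in at_bot. norm (norm_pdf 1 b / b) \<le> - inverse b"
    proof (rule eventually_mono[OF eventually_gt_at_bot[of 0]])
      fix b :: real assume b: "b < 0"
      have "exp (- b\<^sup>2 / 2) \<le> 1" by simp
      moreover have "sqrt (2 * pi) \<ge> 1"
        using pi_gt3 by (simp add: real_le_rsqrt)
      ultimately have "exp (- b\<^sup>2 / 2) \<le> sqrt (2 * pi)" by linarith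
      then have "norm_pdf 1 b \<le> 1"
        by (simp add: norm_pdf_def std_normal_density_def divide_le_eq)
      then show "norm (norm_pdf 1 b / b) \<le> - inverse b"
        using b norm_pdf_pos[of 1 b] by (simp add: divide_simps)
    qed
    show "((\<lambda>b::real. - inverse b) \<longlongrightarrow> 0) at_bot"
      by real_asymp
  qed
  have "(\<xi> \<longlongrightarrow> 0) at_bot"
    using tendsto_add[OF lim1 lim2] by (simp add: \<xi>_def[abs_def])
  then have "\<xi> a \<le> 0"
    by (rule tendsto_lowerbound) (auto intro!: eventually_mono[OF eventually_gt_at_bot[of a]] le)
  then show ?thesis
    using assms by (simp add: \<xi>_def field_simps)
qed

text \<open>Since \<open>alpha\<close> is a definite description, existence and uniqueness come
  first. The difference \<open>f\<close> of the two sides has derivative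
  \<open>2 * a * norm_cdf 1 a\<close>, so it increases strictly on the nonnegative axis, from a
  negative value at 0 to a positive one at 1.\<close>

lemma alpha_bounds: "0 < alpha" "alpha < 1"
proof -
  define f where "f a = a * norm_pdf 1 a - (1 - a\<^sup>2) * norm_cdf 1 a" for a :: real
  have der: "(f has_real_derivative 2 * a * norm_cdf 1 a) (at a)" for a
    unfolding f_def[abs_def]
    by (auto intro!: derivative_eq_intros norm_cdf_DERIV norm_pdf_DERIV
             simp: algebra_simps power2_eq_square)
  have neg: "f a < 0" if "a \<le> 0" for a
  proof (cases "a = 0")
    case False
    with that have a: "a < 0" by simp
    \<comment> \<open>Multiplied by \<open>- a\<close>, the Mills bound reads
      \<open>a * norm_pdf 1 a <= - a^2 * norm_cdf 1 a\<close>, which cancels the quadratic term of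
      \<open>f\<close>.\<close>
    have "(- a) * (- a * norm_cdf 1 a) \<le> (- a) * norm_pdf 1 a"
      using mills_upper_bound[OF a] a by (intro mult_left_mono) auto
    then have "f a \<le> - norm_cdf 1 a"
      by (simp add: f_def algebra_simps power2_eq_square)
    then show ?thesis using norm_cdf_1_pos[of a] by linarith
  qed (simp add: f_def norm_cdf_1_pos)
  have incr: "f a < f b" if "0 \<le> a" "a < b" for a b
  proof (rule DERIV_pos_imp_increasing_open[OF that(2)])
    show "\<exists>y. (f has_real_derivative y) (at x) \<and> 0 < y" if "a < x" "x < b" for x
      using der[of x] that \<open>0 \<le> a\<close> norm_cdf_1_pos[of x] by (intro exI[of _ "2 * x * norm_cdf 1 x"]) simp
    show "continuous_on {a..b} f"
      using der by (intro DERIV_continuous_on) (auto intro: DERIV_subset)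
  qed
  have "\<exists>a\<ge>0. a \<le> 1 \<and> f a = 0"
  proof (rule IVT')
    show "continuous_on {0..1} f"
      using der by (intro DERIV_continuous_on) (auto intro: DERIV_subset)
  qed (use neg[of 0] norm_pdf_pos[of 1 1] in \<open>simp_all add: f_def\<close>)
  then obtain a where a: "0 \<le> a" "a \<le> 1" "f a = 0" by blast
  have "a \<noteq> 0" "a \<noteq> 1"
    using a(3) neg[of 0] norm_pdf_pos[of 1 1] by (auto simp: f_def)
  moreover have "alpha = a"
    unfolding alpha_def
  proof (rule the_equality)
    show "a * norm_pdf 1 a = (1 - a\<^sup>2) * norm_cdf 1 a" using a(3) by (simp add: f_def)
    fix b assume "b * norm_pdf 1 b = (1 - b\<^sup>2) * norm_cdf 1 b"
    then have b: "f b = 0" by (simp add: f_def)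
    then have "b > 0" using neg[of b] by (cases "b \<le> 0") auto
    then show "b = a" using incr[of a b] incr[of b a] a b by (cases a b rule: linorder_cases) auto
  qed
  ultimately show "0 < alpha" "alpha < 1" using a by auto
qed

lemma K_const_pos: "c > 0 \<Longrightarrow> K_const c > 0"
  by (simp add: K_const_def alpha_bounds norm_pdf_pos norm_cdf_pos)

section \<open>Scaling of h\<close>

lemma h_1: "h c 1 u = K_const c * (LBINT k:{0..}. exp (k * u - c / 2 * k\<^sup>2))"
  by (simp add: h_def)

text \<open>Brownian scaling, read off the closed form. It sends every boundary point
  \<open>alpha * sqrt s\<close> to the single point \<open>alpha\<close> at time 1.\<close>

lemma h_scale:
  assumes "c > 0" "s > 0"
  shows "h c s y = h c 1 (y / sqrt s) / sqrt s"
proof -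
  have "norm_cdf (c * s) y = norm_cdf c (y / sqrt s)"
    using assms by (simp add: norm_cdf_scale[of "c * s"] norm_cdf_scale[of c] real_sqrt_mult field_simps)
  moreover have "norm_pdf (c * s) y = norm_pdf c (y / sqrt s) / sqrt s"
    using assms by (simp add: norm_pdf_def normal_density_def real_sqrt_mult power_divide
        power_mult_distrib field_simps)
  moreover have "h c 1 (y / sqrt s) / sqrt s
      = K_const c * (1 / c) * (norm_cdf c (y / sqrt s) / norm_pdf c (y / sqrt s)) / sqrt s"
    using assms by (simp add: h_closed_form)
  moreover have "A / (c * s) * (B / (D / sqrt s)) = A * (1 / c) * (B / D) / sqrt s" for A B D
  proof -
    have "sqrt s / s = 1 / sqrt s"
      using assms real_div_sqrt[of s] by (simp add: field_simps)
    moreover have "A / (c * s) * (B / (D / sqrt s)) = A * (1 / c) * (B / D) * (sqrt s / s)"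
      by (simp add: mult_ac)
    ultimately show ?thesis by simp
  qed
  ultimately show ?thesis
    using assms by (simp add: h_closed_form)
qed

text \<open>The constant \<open>K_const c\<close> is chosen for exactly this: the value at
  \<open>alpha\<close> is the same for all \<open>c\<close>, which allows comparisons between
  different values of \<open>c\<close>.\<close>

lemma h_alpha: "c > 0 \<Longrightarrow> h c 1 alpha = alpha"
  using norm_pdf_pos[of c alpha] norm_cdf_pos[of c alpha]
  by (simp add: h_closed_form K_const_def)

lemma h_boundary: "c > 0 \<Longrightarrow> s > 0 \<Longrightarrow> h c s (alpha * sqrt s) = alpha / sqrt s"
  by (simp add: h_scale[of c s] h_alpha)

lemma set_integrable_h:
  fixes c s y :: real
  assumes "c > 0" "s > 0"
  shows "set_integrable lborel {0..} (\<lambda>a. exp (a * y - c / 2 * a\<^sup>2 * s))"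
  using set_integrable_exp_quadratic[of "c * s" y] assms by (simp add: mult_ac)

lemma h_mono:
  assumes "c > 0" "s > 0" "y \<le> z"
  shows "h c s y \<le> h c s z"
  unfolding h_def
  using assms K_const_pos[of c]
  by (intro mult_left_mono set_integral_mono set_integrable_h) (auto intro: mult_left_mono)

lemma h_pos: "c > 0 \<Longrightarrow> s > 0 \<Longrightarrow> 0 < h c s y"
  by (simp add: h_closed_form K_const_pos norm_pdf_pos norm_cdf_pos)

text \<open>For fixed \<open>a\<close> the integrand is the exponential of an affine function of
  \<open>y\<close>, and integration against a positive constant preserves convexity.\<close>

lemma h_convex:
  assumes "c > 0" "s > 0" "0 \<le> r" "r \<le> 1"
  shows "h c s ((1 - r) * y + r * z) \<le> (1 - r) * h c s y + r * h c s z"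
proof -
  define E where "E y a = exp (a * y - c / 2 * a\<^sup>2 * s)" for y a :: real
  have int: "set_integrable lborel {0..} (E y)" for y
    unfolding E_def[abs_def] by (rule set_integrable_h[OF assms(1,2)])
  have h: "h c s y = K_const c * (LBINT a:{0..}. E y a)" for y
    by (simp add: h_def E_def)
  have int2: "set_integrable lborel {0..} (\<lambda>a. r * E y a)" for r y
    using int by (intro set_integrable_mult_right) auto
  have "(LBINT a:{0..}. E ((1 - r) * y + r * z) a) \<le> (LBINT a:{0..}. (1 - r) * E y a + r * E z a)"
  proof (rule set_integral_mono[OF int set_integral_add(1)[OF int2 int2]])
    fix a :: real
    have "exp ((1 - r) *\<^sub>R (a * y - c / 2 * a\<^sup>2 * s) + r *\<^sub>R (a * z - c / 2 * a\<^sup>2 * s))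
      \<le> (1 - r) * exp (a * y - c / 2 * a\<^sup>2 * s) + r * exp (a * z - c / 2 * a\<^sup>2 * s)"
      using assms by (intro convex_onD[OF exp_convex]) auto
    moreover have "(1 - r) *\<^sub>R (a * y - c / 2 * a\<^sup>2 * s) + r *\<^sub>R (a * z - c / 2 * a\<^sup>2 * s)
      = a * ((1 - r) * y + r * z) - c / 2 * a\<^sup>2 * s"
      by (simp add: field_simps)
    ultimately show "E ((1 - r) * y + r * z) a \<le> (1 - r) * E y a + r * E z a"
      unfolding E_def by metis
  qed
  also have "\<dots> = (1 - r) * (LBINT a:{0..}. E y a) + r * (LBINT a:{0..}. E z a)"
    by (subst set_integral_add(2)[OF int2 int2]) simp
  finally have "K_const c * (LBINT a:{0..}. E ((1 - r) * y + r * z) a) \<le> K_const c * \<dots>"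
    using K_const_pos[OF assms(1)] by (intro mult_left_mono) auto
  then show ?thesis
    unfolding h by (simp add: algebra_simps)
qed

section \<open>Sign of the one-step drift of h\<close>

text \<open>In the applications \<open>r\<close> is the weight at the point where \<open>f\<close>
  changes sign. The third premise then covers both sides at once: the weight is at least
  \<open>r\<close> where \<open>f\<close> is positive and at most \<open>r\<close> where
  \<open>f\<close> is negative.\<close>

lemma set_integral_reweight_nonneg:
  fixes f \<rho> :: "real \<Rightarrow> real"
  assumes "set_integrable lborel {0..} f" "set_integrable lborel {0..} (\<lambda>a. \<rho> a * f a)"
    and "\<And>a. a \<ge> 0 \<Longrightarrow> r * f a \<le> \<rho> a * f a" "r \<ge> 0"
    and "0 \<le> (LBINT a:{0..}. f a)"
  shows "0 \<le> (LBINT a:{0..}. \<rho> a * f a)"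
proof -
  have "0 \<le> r * (LBINT a:{0..}. f a)"
    using assms by simp
  also have "\<dots> = (LBINT a:{0..}. r * f a)"
    by simp
  also have "\<dots> \<le> (LBINT a:{0..}. \<rho> a * f a)"
    using assms by (intro set_integral_mono set_integrable_mult_right) auto
  finally show ?thesis .
qed

text \<open>Going from \<open>c\<close> down to \<open>c'\<close> multiplies the integrand by
  \<open>exp ((c - c') / 2 * k^2)\<close>, which increases in \<open>k\<close> and so favours the
  region beyond \<open>k0\<close>, where \<open>f\<close> is nonnegative. This carries both defining
  relations, of \<open>c1\<close> and of \<open>c2\<close>, over to their minimum.\<close>

lemma gaussian_single_crossing:
  fixes f :: "real \<Rightarrow> real"
  assumes "c' \<le> c"
    and "set_integrable lborel {0..} (\<lambda>k. exp (- c / 2 * k\<^sup>2) * f k)"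
    and "set_integrable lborel {0..} (\<lambda>k. exp (- c' / 2 * k\<^sup>2) * f k)"
    and "k0 \<ge> 0"
    and "\<And>k. 0 \<le> k \<Longrightarrow> k \<le> k0 \<Longrightarrow> f k \<le> 0" "\<And>k. k0 \<le> k \<Longrightarrow> 0 \<le> f k"
    and "0 \<le> (LBINT k:{0..}. exp (- c / 2 * k\<^sup>2) * f k)"
  shows "0 \<le> (LBINT k:{0..}. exp (- c' / 2 * k\<^sup>2) * f k)"
proof -
  define \<rho> where "\<rho> k = exp ((c - c') / 2 * k\<^sup>2)" for k :: real
  have eq: "exp (- c' / 2 * k\<^sup>2) * f k = \<rho> k * (exp (- c / 2 * k\<^sup>2) * f k)" for k
  proof -
    have "exp (- c' / 2 * k\<^sup>2) = \<rho> k * exp (- c / 2 * k\<^sup>2)"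
      unfolding \<rho>_def exp_add[symmetric] by (simp add: field_simps)
    then show ?thesis by simp
  qed
  have mono: "\<rho> k \<le> \<rho> l" if "0 \<le> k" "k \<le> l" for k l
    using that assms(1) by (auto simp: \<rho>_def intro!: mult_left_mono power_mono)
  have "\<rho> k0 * f k \<le> \<rho> k * f k" if "k \<ge> 0" for k
    using that assms(4-6) mono[of k k0] mono[of k0 k]
    by (cases "k \<le> k0") (auto intro: mult_right_mono mult_right_mono_neg)
  then have "\<rho> k0 * (exp (- c / 2 * k\<^sup>2) * f k) \<le> \<rho> k * (exp (- c / 2 * k\<^sup>2) * f k)"
    if "k \<ge> 0" for k
    using that mult_left_mono[of "\<rho> k0 * f k" "\<rho> k * f k" "exp (- c / 2 * k\<^sup>2)"]
    by (simp add: mult_ac)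
  then show ?thesis
    using assms(2,3,7) unfolding eq
    by (intro set_integral_reweight_nonneg[where r = "\<rho> k0" and \<rho> = \<rho>
        and f = "\<lambda>k. exp (- c / 2 * k\<^sup>2) * f k"]) (simp_all, simp add: \<rho>_def)
qed

text \<open>The expected change of \<open>h c\<close> in one step of the walk; the equation for
  \<open>c1\<close> says that it vanishes at \<open>(T, alpha * sqrt T)\<close>.\<close>

definition drift :: "real \<Rightarrow> real \<Rightarrow> real \<Rightarrow> real" where
  "drift c s y = 1 / 2 * (h c (s + 1) (y - 1) + h c (s + 1) (y + 1)) - h c s y"

text \<open>Averaging the exponentials at \<open>y - 1\<close> and \<open>y + 1\<close> produces
  \<open>cosh a\<close>, and the unit of time produces \<open>exp (- c / 2 * a^2)\<close>. The sign
  of the integrand thus depends on \<open>a\<close> and \<open>c\<close> alone.\<close>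

lemma drift_eq:
  fixes c s y :: real
  assumes "c > 0" "s > 0"
  defines "f \<equiv> \<lambda>a. exp (a * y - c / 2 * a\<^sup>2 * s) * (cosh a * exp (- c / 2 * a\<^sup>2) - 1)"
  shows "set_integrable lborel {0..} f"
    and "drift c s y = K_const c * (LBINT a:{0..}. f a)"
proof -
  define E where "E s y a = exp (a * y - c / 2 * a\<^sup>2 * s)" for s y a :: real
  have int: "set_integrable lborel {0..} (E s y)" if "s > 0" for s y
    unfolding E_def[abs_def] by (rule set_integrable_h[OF assms(1) that])
  have h: "h c s y = K_const c * (LBINT a:{0..}. E s y a)" for s y
    by (simp add: h_def E_def)
  have f: "f a = (1 / 2 * E (s + 1) (y - 1) a + 1 / 2 * E (s + 1) (y + 1) a) - E s y a" for a
  proof -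
    have "E (s + 1) (y - 1) a = exp (a * y - c / 2 * a\<^sup>2 * s) * (exp (- a) * exp (- c / 2 * a\<^sup>2))"
      "E (s + 1) (y + 1) a = exp (a * y - c / 2 * a\<^sup>2 * s) * (exp a * exp (- c / 2 * a\<^sup>2))"
      unfolding E_def exp_add[symmetric] by (simp_all add: algebra_simps)
    then show ?thesis
      by (simp add: f_def E_def cosh_field_def algebra_simps)
  qed
  have s1: "s + 1 > 0" using assms by simp
  have ih: "set_integrable lborel {0..} (\<lambda>a. 1 / 2 * E (s + 1) z a)" for z
    by (intro set_integrable_mult_right int[OF s1])
  note i2 = set_integral_add(1)[OF ih ih]
  show "set_integrable lborel {0..} f"
    using set_integral_diff(1)[OF i2 int[OF assms(2)]] unfolding f[abs_def] .
  show "drift c s y = K_const c * (LBINT a:{0..}. f a)"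
    unfolding f[abs_def] set_integral_diff(2)[OF i2 int[OF assms(2)]] set_integral_add(2)[OF ih ih]
    by (simp add: drift_def h algebra_simps)
qed

text \<open>The derivative has the sign of \<open>x * tanh x - 2 * ln (cosh x)\<close>. This
  vanishes at 0 and has derivative \<open>(x - sinh x * cosh x) / (cosh x)^2\<close>, which is
  nonpositive because \<open>x <= sinh x <= sinh x * cosh x\<close>.\<close>

lemma ln_cosh_over_square_antimono:
  fixes a b :: real
  assumes "0 < a" "a \<le> b"
  shows "ln (cosh b) / b\<^sup>2 \<le> ln (cosh a) / a\<^sup>2"
proof (rule DERIV_nonpos_imp_nonincreasing[OF assms(2)])
  fix x assume "a \<le> x" "x \<le> b"
  then have x: "x > 0" using assms by simp
  define g where "g y = y * tanh y - 2 * ln (cosh y)" for y :: real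
  have "g x \<le> g 0"
  proof (rule DERIV_nonpos_imp_nonincreasing[of 0 x g])
    fix y :: real assume y: "0 \<le> y"
    have "(g has_real_derivative (1 * tanh y + (1 - tanh y ^ 2) * 1 * y) - 2 * (1 / cosh y * (sinh y * 1))) (at y)"
      unfolding g_def[abs_def]
      by (rule derivative_eq_intros refl | simp add: cosh_real_pos cosh_real_nonzero)+
    moreover have "(1 * tanh y + (1 - tanh y ^ 2) * 1 * y) - 2 * (1 / cosh y * (sinh y * 1)) \<le> 0"
    proof -
      have "y \<le> sinh y"
      proof -
        have "sinh 0 - 0 \<le> sinh y - y"
          by (rule DERIV_nonneg_imp_nondecreasing[OF y])
             (auto intro!: derivative_eq_intros exI simp: cosh_real_ge_1)
        then show ?thesis by simp
      qed
      then have "y \<le> sinh y * cosh y"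
        using y cosh_real_ge_1[of y] mult_left_mono[of 1 "cosh y" "sinh y"] by simp
      then have "(y - sinh y * cosh y) / cosh y ^ 2 \<le> 0"
        by (simp add: divide_nonpos_nonneg)
      moreover have "1 - tanh y ^ 2 = 1 / cosh y ^ 2"
      proof -
        have "1 - tanh y ^ 2 = (cosh y ^ 2 - sinh y ^ 2) / cosh y ^ 2"
          using cosh_real_pos[of y] by (simp add: tanh_def power_divide diff_divide_distrib)
        then show ?thesis by (simp add: hyperbolic_pythagoras)
      qed
      moreover have "tanh y + 1 / cosh y ^ 2 * y - 2 * (1 / cosh y * sinh y)
          = (y - sinh y * cosh y) / cosh y ^ 2"
        using cosh_real_pos[of y] by (simp add: tanh_def field_simps power2_eq_square)
      ultimately show ?thesis by simp
    qed
    ultimately show "\<exists>d. (g has_real_derivative d) (at y) \<and> d \<le> 0"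
      by blast
  qed (use x in simp)
  then have "x * tanh x \<le> 2 * ln (cosh x)" by (simp add: g_def)
  moreover have "((\<lambda>x. ln (cosh x) / x\<^sup>2) has_real_derivative
      (x * tanh x - 2 * ln (cosh x)) / x ^ 3) (at x)"
    using x by (auto intro!: derivative_eq_intros simp: cosh_real_pos tanh_def field_simps
                power2_eq_square power3_eq_cube)
  ultimately show "\<exists>d. ((\<lambda>x. ln (cosh x) / x\<^sup>2) has_real_derivative d) (at x) \<and> d \<le> 0"
    using x by (intro exI conjI) (auto simp: divide_nonpos_pos)
qed

text \<open>After taking logarithms, the equation for \<open>a0\<close> says
  \<open>c / 2 = ln (cosh a0) / a0^2\<close>, and monotonicity of this quotient decides the sign on
  either side of \<open>a0\<close>.\<close>

lemma cosh_gaussian_crossing: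
  fixes c a0 :: real
  assumes "a0 > 0" "cosh a0 * exp (- c / 2 * a0\<^sup>2) = 1"
  shows "0 \<le> a \<Longrightarrow> a \<le> a0 \<Longrightarrow> 0 \<le> cosh a * exp (- c / 2 * a\<^sup>2) - 1"
    and "a0 \<le> a \<Longrightarrow> cosh a * exp (- c / 2 * a\<^sup>2) - 1 \<le> 0"
proof -
  have expln: "cosh a * exp (- c / 2 * a\<^sup>2) = exp (ln (cosh a) - c / 2 * a\<^sup>2)" for a
    using exp_add[of "ln (cosh a)" "- c / 2 * a\<^sup>2"] by (simp add: cosh_real_pos)
  have "ln (cosh a0) - c / 2 * a0\<^sup>2 = 0"
    using assms(2) by (simp only: expln exp_eq_one_iff)
  then have c: "c / 2 = ln (cosh a0) / a0\<^sup>2"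
    using assms(1) by (simp add: field_simps)
  show "0 \<le> cosh a * exp (- c / 2 * a\<^sup>2) - 1" if "0 \<le> a" "a \<le> a0"
  proof (cases "a = 0")
    case False
    then have "c / 2 \<le> ln (cosh a) / a\<^sup>2"
      unfolding c using that by (intro ln_cosh_over_square_antimono) auto
    then have "c / 2 * a\<^sup>2 \<le> ln (cosh a)"
      using False by (simp add: pos_le_divide_eq)
    then show ?thesis unfolding expln by simp
  qed simp
  show "cosh a * exp (- c / 2 * a\<^sup>2) - 1 \<le> 0" if "a0 \<le> a"
  proof -
    have "ln (cosh a) / a\<^sup>2 \<le> c / 2"
      unfolding c using that assms(1) by (intro ln_cosh_over_square_antimono) auto
    then have "ln (cosh a) \<le> c / 2 * a\<^sup>2"
      using assms(1) that by (simp add: pos_divide_le_eq)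
    then show ?thesis unfolding expln by simp
  qed
qed

text \<open>On the boundary the exponents at times \<open>s\<close> and \<open>T\<close> differ by a concave quadratic in \<open>a\<close>,
  which vanishes at 0 and has a root at most \<open>a0\<close>; hence \<open>a0\<close> also separates the two signs of
  the weight's deviation from its value at \<open>a0\<close>.\<close>

lemma drift_nonneg_later:
  assumes c: "c > 0" and T: "T > 0" "T \<le> s" and y: "y \<le> b * sqrt s" and b: "b \<ge> 0"
    and a0: "a0 > 0" "cosh a0 * exp (- c / 2 * a0\<^sup>2) = 1" "b / (a0 * c) \<le> sqrt T"
    and D: "drift c T (b * sqrt T) \<ge> 0"
  shows "drift c s y \<ge> 0"
proof -
  define f where "f s y a = exp (a * y - c / 2 * a\<^sup>2 * s) * (cosh a * exp (- c / 2 * a\<^sup>2) - 1)"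
    for s y a :: real
  \<comment> \<open>\<open>q\<close> is the logarithm of the ratio between the integrands at
    \<open>(s, y)\<close> and at \<open>(T, b * sqrt T)\<close>.\<close>
  define q where "q a = a * (y - b * sqrt T) - c / 2 * a\<^sup>2 * (s - T)" for a
  have s: "s > 0" using T by simp
  have int: "set_integrable lborel {0..} (f s y)" "set_integrable lborel {0..} (f T (b * sqrt T))"
    unfolding f_def[abs_def] by (rule drift_eq(1)[OF c s], rule drift_eq(1)[OF c T(1)])
  \<comment> \<open>The second factor is nonnegative for \<open>a >= 0\<close> (fact
    \<open>pos\<close>), so the sign of the difference is that of \<open>a0 - a\<close>.\<close>
  have q0: "q a - q a0 = (a0 - a) * (b * sqrt s - y + (sqrt s - sqrt T) * (c / 2 * (a + a0) * (sqrt s + sqrt T) - b))" for a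
  proof -
    have "s - T = (sqrt s - sqrt T) * (sqrt s + sqrt T)"
      using s T by (simp add: algebra_simps)
    then show ?thesis
      unfolding q_def by (simp only:) (simp add: field_simps power2_eq_square)
  qed
  have sq: "sqrt T \<le> sqrt s" using T by simp
  have pos: "0 \<le> b * sqrt s - y + (sqrt s - sqrt T) * (c / 2 * (a + a0) * (sqrt s + sqrt T) - b)"
    if "a \<ge> 0" for a
  proof -
    \<comment> \<open>The lower bound on the horizon \<open>T\<close> enters here.\<close>
    have "b \<le> c / 2 * a0 * (2 * sqrt T)"
      using a0(1,3) c by (simp add: field_simps)
    also have "\<dots> \<le> c / 2 * (a + a0) * (sqrt s + sqrt T)"
      using c a0(1) that sq T by (intro mult_mono) auto
    finally show ?thesis using y sq by (simp add: mult_nonneg_nonneg)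
  qed
  have ratio: "f s y a = exp (q a) * f T (b * sqrt T) a" for a
  proof -
    have "a * y - c / 2 * a\<^sup>2 * s = q a + (a * (b * sqrt T) - c / 2 * a\<^sup>2 * T)"
      by (simp add: q_def field_simps)
    then show ?thesis unfolding f_def by (simp only: exp_add mult.assoc)
  qed
  have "0 \<le> (LBINT a:{0..}. exp (q a) * f T (b * sqrt T) a)"
  proof (rule set_integral_reweight_nonneg[where r = "exp (q a0)"])
    show "set_integrable lborel {0..} (\<lambda>a. exp (q a) * f T (b * sqrt T) a)"
      using int(1) unfolding ratio[abs_def] .
    have "drift c T (b * sqrt T) = K_const c * (LBINT a:{0..}. f T (b * sqrt T) a)"
      unfolding f_def by (rule drift_eq(2)[OF c T(1)])
    then show "0 \<le> (LBINT a:{0..}. f T (b * sqrt T) a)"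
      using D K_const_pos[OF c] by (simp add: zero_le_mult_iff)
    fix a :: real assume a: "a \<ge> 0"
    show "exp (q a0) * f T (b * sqrt T) a \<le> exp (q a) * f T (b * sqrt T) a"
    proof (cases "a \<le> a0")
      case True
      have "0 \<le> q a - q a0" unfolding q0 using True pos[OF a] by simp
      moreover have "0 \<le> f T (b * sqrt T) a"
        unfolding f_def using cosh_gaussian_crossing(1)[OF a0(1,2) a True] by simp
      ultimately show ?thesis by (intro mult_right_mono) auto
    next
      case False
      have "q a - q a0 \<le> 0" unfolding q0 using False pos[OF a] by (intro mult_nonpos_nonneg) auto
      moreover have "f T (b * sqrt T) a \<le> 0"
        unfolding f_def using cosh_gaussian_crossing(2)[OF a0(1,2), of a] False
        by (simp add: mult_nonneg_nonpos)
      ultimately show ?thesis by (intro mult_right_mono_neg) auto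
    qed
  qed (use int in auto)
  then have "0 \<le> K_const c * (LBINT a:{0..}. f s y a)"
    using K_const_pos[OF c] unfolding ratio by (intro mult_nonneg_nonneg) auto
  also have "\<dots> = drift c s y"
    unfolding f_def by (rule drift_eq(2)[OF c s, symmetric])
  finally show ?thesis .
qed

text \<open>In the scaled variable all three terms of the drift share the weight
  \<open>exp (- c / 2 * k^2)\<close>, and the remaining factor \<open>f\<close> is free of
  \<open>c\<close>. This is the shape that \<open>gaussian_single_crossing\<close> requires; in
  \<open>drift_eq\<close> the parameter also sits inside the factor that changes sign.\<close>

lemma drift_at_boundary_scaled:
  assumes "c > 0" "T > 0"
  defines "f \<equiv> \<lambda>k. 1 / 2 / sqrt (T + 1) * (exp (k * ((alpha * sqrt T - 1) / sqrt (T + 1)))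
        + exp (k * ((alpha * sqrt T + 1) / sqrt (T + 1)))) - exp (k * alpha) / sqrt T"
  shows "set_integrable lborel {0..} (\<lambda>k. exp (- c / 2 * k\<^sup>2) * f k)"
    and "drift c T (alpha * sqrt T) = K_const c * (LBINT k:{0..}. exp (- c / 2 * k\<^sup>2) * f k)"
proof -
  define E where "E u k = exp (k * u - c / 2 * k\<^sup>2)" for u k :: real
  define p where "p = (alpha * sqrt T - 1) / sqrt (T + 1)"
  define q where "q = (alpha * sqrt T + 1) / sqrt (T + 1)"
  define r where "r = 1 / 2 / sqrt (T + 1)"
  have int: "set_integrable lborel {0..} (E u)" for u
    unfolding E_def[abs_def] by (rule set_integrable_exp_quadratic[OF assms(1)])
  have intm: "set_integrable lborel {0..} (\<lambda>k. m * E u k)" for m u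
    by (intro set_integrable_mult_right int)
  have f: "exp (- c / 2 * k\<^sup>2) * f k = (r * E p k + r * E q k) - 1 / sqrt T * E alpha k" for k
  proof -
    have "E u k = exp (- c / 2 * k\<^sup>2) * exp (k * u)" for u
      by (simp add: E_def exp_add[symmetric])
    then show ?thesis by (simp add: f_def p_def q_def r_def algebra_simps)
  qed
  note i2 = set_integral_add(1)[OF intm intm]
  show "set_integrable lborel {0..} (\<lambda>k. exp (- c / 2 * k\<^sup>2) * f k)"
    using set_integral_diff(1)[OF i2 intm] unfolding f .
  have h1: "h c s y = K_const c * (LBINT k:{0..}. E (y / sqrt s) k) / sqrt s" if "s > 0" for s y
    using h_scale[OF assms(1) that, of y] by (simp add: h_1 E_def)
  have "h c (T + 1) (alpha * sqrt T - 1) = K_const c * (LBINT k:{0..}. E p k) / sqrt (T + 1)"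
    "h c (T + 1) (alpha * sqrt T + 1) = K_const c * (LBINT k:{0..}. E q k) / sqrt (T + 1)"
    "h c T (alpha * sqrt T) = K_const c * (LBINT k:{0..}. E alpha k) / sqrt T"
    using assms(2) by (simp_all add: h1 p_def q_def)
  then show "drift c T (alpha * sqrt T) = K_const c * (LBINT k:{0..}. exp (- c / 2 * k\<^sup>2) * f k)"
    unfolding f set_integral_diff(2)[OF i2 intm] set_integral_add(2)[OF intm intm]
    by (simp add: drift_def r_def algebra_simps)
qed

text \<open>Up to the positive factor \<open>exp (k * alpha)\<close>, the integrand \<open>f\<close>
  is a convex function \<open>g\<close> that is negative at 0 and reaches 0 later. Such a function
  changes sign once, from minus to plus.\<close>

lemma drift_at_boundary_nonneg:
  assumes "0 < c" "c \<le> c1" "T > 0" "drift c1 T (alpha * sqrt T) \<ge> 0"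
  shows "drift c T (alpha * sqrt T) \<ge> 0"
proof -
  define p where "p = (alpha * sqrt T - 1) / sqrt (T + 1) - alpha"
  define q where "q = (alpha * sqrt T + 1) / sqrt (T + 1) - alpha"
  define r1 where "r1 = 1 / 2 / sqrt (T + 1)"
  define r0 where "r0 = 1 / sqrt T"
  define f where "f k = r1 * (exp (k * (p + alpha)) + exp (k * (q + alpha))) - exp (k * alpha) / sqrt T" for k
  define g where "g k = r1 * (exp (k * p) + exp (k * q)) - r0" for k
  have fg: "f k = exp (k * alpha) * g k" for k
    unfolding f_def g_def by (simp add: r0_def exp_add[symmetric] algebra_simps)
  have r: "r1 > 0" "r0 > 0" "2 * r1 < r0"
    using assms(3) by (simp_all add: r1_def r0_def frac_less2)
  \<comment> \<open>As \<open>alpha < 1\<close>, the up-step from the boundary ends strictly above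
    the boundary of the next time. This positive exponent forces \<open>g\<close> to reach
    0.\<close>
  have q: "q > 0"
  proof -
    have "sqrt (T + 1) \<le> sqrt T + 1"
      using assms(3) by (intro real_le_lsqrt) (auto simp: power2_eq_square algebra_simps)
    then have "alpha * sqrt (T + 1) \<le> alpha * sqrt T + alpha"
      using alpha_bounds mult_left_mono[of "sqrt (T + 1)" "sqrt T + 1" alpha] by (simp add: algebra_simps)
    also have "\<dots> < alpha * sqrt T + 1" using alpha_bounds by simp
    finally show ?thesis using assms(3) by (simp add: q_def field_simps)
  qed
  have cont: "continuous_on S g" for S
    unfolding g_def by (intro continuous_intros)
  have g0: "g 0 < 0" using r by (simp add: g_def)
  \<comment> \<open>At \<open>ln (r0 / r1) / q\<close> the second exponential alone already cancels
    \<open>r0\<close>.\<close>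
  have "\<exists>k\<ge>0. k \<le> ln (r0 / r1) / q \<and> g k = 0"
  proof (rule IVT')
    have "g (ln (r0 / r1) / q) = r1 * exp (ln (r0 / r1) / q * p)"
      using q r by (simp add: g_def distrib_left)
    then show "0 \<le> g (ln (r0 / r1) / q)" using r by simp
    show "0 \<le> ln (r0 / r1) / q" using q r by (simp add: field_simps)
  qed (use g0 cont in auto)
  then obtain k0 where k0: "0 \<le> k0" "g k0 = 0" by blast
  have "k0 > 0" using k0 g0 by (cases "k0 = 0") auto
  have convex: "g ((1 - l) * x + l * y) \<le> (1 - l) * g x + l * g y" if "0 \<le> l" "l \<le> 1" for l x y
  proof -
    have "exp (((1 - l) * x + l * y) * w) \<le> (1 - l) * exp (x * w) + l * exp (y * w)" for w
      using that convex_onD[OF exp_convex, of l "x * w" "y * w"] by (simp add: algebra_simps)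
    from mult_left_mono[OF add_mono[OF this[of p] this[of q]], of r1]
    show ?thesis using r by (simp add: g_def algebra_simps)
  qed
  \<comment> \<open>Both signs follow from chords: \<open>k\<close> lies between 0 and
    \<open>k0\<close> here, and \<open>k0\<close> lies between 0 and \<open>k\<close> in the next
    claim.\<close>
  have neg: "g k \<le> 0" if "0 \<le> k" "k \<le> k0" for k
  proof -
    have "g k \<le> (1 - k / k0) * g 0 + k / k0 * g k0"
      using convex[of "k / k0" 0 k0] that \<open>k0 > 0\<close> by simp
    also have "\<dots> \<le> 0"
      using that \<open>k0 > 0\<close> g0 k0 by (auto intro!: mult_nonneg_nonpos)
    finally show ?thesis .
  qed
  have pos: "0 \<le> g k" if "k0 \<le> k" for k
  proof -
    have "0 \<le> (1 - k0 / k) * g 0 + k0 / k * g k"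
      using convex[of "k0 / k" 0 k] that \<open>k0 > 0\<close> k0 by simp
    moreover have "(1 - k0 / k) * g 0 \<le> 0"
      using that \<open>k0 > 0\<close> g0 by (auto intro!: mult_nonneg_nonpos)
    ultimately have "0 \<le> k0 / k * g k" by linarith
    then show ?thesis using that \<open>k0 > 0\<close> by (simp add: zero_le_mult_iff zero_le_divide_iff)
  qed
  have c1: "c1 > 0" using assms by simp
  note scaled = drift_at_boundary_scaled[OF _ assms(3)]
  have f': "f = (\<lambda>k. 1 / 2 / sqrt (T + 1) * (exp (k * ((alpha * sqrt T - 1) / sqrt (T + 1)))
        + exp (k * ((alpha * sqrt T + 1) / sqrt (T + 1)))) - exp (k * alpha) / sqrt T)"
    unfolding f_def[abs_def] p_def q_def r1_def by simp
  have f_int: "set_integrable lborel {0..} (\<lambda>k. exp (- c / 2 * k\<^sup>2) * f k)" if "c > 0" for c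
    using scaled(1)[OF that] unfolding f' .
  have "0 \<le> (LBINT k:{0..}. exp (- c / 2 * k\<^sup>2) * f k)"
  proof (rule gaussian_single_crossing[OF assms(2) f_int[OF c1] f_int[OF assms(1)] k0(1)])
    show "0 \<le> (LBINT k:{0..}. exp (- c1 / 2 * k\<^sup>2) * f k)"
      using assms(4) K_const_pos[OF c1] unfolding f' scaled(2)[OF c1] by (simp add: zero_le_mult_iff)
  qed (use neg pos in \<open>auto simp: fg mult_le_0_iff\<close>)
  then have "0 \<le> K_const c * (LBINT k:{0..}. exp (- c / 2 * k\<^sup>2) * f k)"
    using K_const_pos[OF assms(1)] by (intro mult_nonneg_nonneg) auto
  then show ?thesis
    unfolding scaled(2)[OF assms(1)] f' .
qed

section \<open>Comparison of h with the payoff below the boundary\<close>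

text \<open>By \<open>h_alpha\<close>, the number \<open>v\<close> is \<open>v / alpha\<close> times
  the integral at \<open>alpha\<close>, with the same factor \<open>K_const c\<close> as in
  \<open>h c 1 v\<close>. Hence \<open>v - h c 1 v\<close> is \<open>K_const c\<close> times a
  Gaussian integral of a function \<open>f\<close> free of \<open>c\<close>, which changes sign
  once, at \<open>k0\<close>.\<close>

lemma h_le_id:
  assumes "0 < c" "c \<le> c2" "v < alpha" "h c2 1 v = v"
  shows "h c 1 v \<le> v"
proof -
  have c2: "c2 > 0" using assms by simp
  define E where "E c u k = exp (k * u - c / 2 * k\<^sup>2)" for c u k :: real
  define \<rho> where "\<rho> = v / alpha"
  define f where "f k = \<rho> * exp (k * alpha) - exp (k * v)" for k
  have v: "v > 0" using h_pos[OF c2, of 1 v] assms by simp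
  then have \<rho>: "0 < \<rho>" "\<rho> < 1" using assms alpha_bounds by (simp_all add: \<rho>_def)
  have int: "set_integrable lborel {0..} (E c u)" if "c > 0" for c u
    unfolding E_def[abs_def] by (rule set_integrable_exp_quadratic[OF that])
  have intm: "set_integrable lborel {0..} (\<lambda>k. m * E c u k)" if "c > 0" for m c u
    using that by (intro set_integrable_mult_right int)
  have f: "exp (- c / 2 * k\<^sup>2) * f k = \<rho> * E c alpha k - E c v k" for c k
  proof -
    have "E c u k = exp (- c / 2 * k\<^sup>2) * exp (k * u)" for u
      by (simp add: E_def exp_add[symmetric])
    then show ?thesis by (simp add: f_def algebra_simps)
  qed
  have f_int: "set_integrable lborel {0..} (\<lambda>k. exp (- c / 2 * k\<^sup>2) * f k)" if "c > 0" for c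
    unfolding f by (rule set_integral_diff(1)[OF intm[OF that] int[OF that]])
  have eq: "K_const c * (LBINT k:{0..}. exp (- c / 2 * k\<^sup>2) * f k) = v - h c 1 v" if "c > 0" for c
  proof -
    have "K_const c * (LBINT k:{0..}. E c alpha k) = alpha" "K_const c * (LBINT k:{0..}. E c v k) = h c 1 v"
      using h_alpha[OF that] by (simp_all add: h_1 E_def)
    moreover have "\<rho> * alpha = v" using alpha_bounds by (simp add: \<rho>_def)
    ultimately show ?thesis
      unfolding f set_integral_diff(2)[OF intm[OF that] int[OF that]]
      by (simp add: right_diff_distrib mult.left_commute[of "K_const c"])
  qed
  define k0 where "k0 = ln (1 / \<rho>) / (alpha - v)"
  have fsign: "f k = exp (k * v) * (\<rho> * exp (k * (alpha - v)) - 1)" for k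
    by (simp add: f_def algebra_simps exp_diff)
  have \<rho>k0: "\<rho> * exp (k0 * (alpha - v)) = 1"
    using \<rho> assms(3) by (simp add: k0_def)
  have mono: "\<rho> * exp (k * (alpha - v)) \<le> \<rho> * exp (l * (alpha - v))" if "k \<le> l" for k l
    using that \<rho> assms(3) by (intro mult_left_mono) auto
  have "0 \<le> (LBINT k:{0..}. exp (- c / 2 * k\<^sup>2) * f k)"
  proof (rule gaussian_single_crossing[OF assms(2)])
    show "0 \<le> k0" using \<rho> assms(3) by (simp add: k0_def)
    show "0 \<le> (LBINT k:{0..}. exp (- c2 / 2 * k\<^sup>2) * f k)"
      using eq[OF c2] K_const_pos[OF c2] assms(4) by simp
    show "f k \<le> 0" if "k \<le> k0" for k
      using mono[OF that] \<rho>k0 by (simp add: fsign mult_le_0_iff)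
    show "0 \<le> f k" if "k0 \<le> k" for k
      using mono[OF that] \<rho>k0 by (simp add: fsign)
  qed (use f_int assms c2 in auto)
  then have "0 \<le> v - h c 1 v"
    unfolding eq[OF assms(1), symmetric] using K_const_pos[OF assms(1)] by simp
  then show ?thesis by simp
qed

text \<open>In the variable \<open>z = y / sqrt s\<close> the claim is \<open>h c 1 z <= z\<close>.
  It holds at \<open>v\<close> by \<open>h_le_id\<close> and with equality at \<open>alpha\<close>,
  hence in between by convexity.\<close>

lemma h_le_payoff:
  assumes "0 < c" "c \<le> c2" "0 < T" "T \<le> s"
    and "h c2 T (alpha * sqrt T - 1) = (alpha * sqrt T - 1) / T"
    and "alpha * sqrt s - 1 \<le> y" "y \<le> alpha * sqrt s"
  shows "h c s y \<le> y / s"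
proof -
  define v where "v = alpha - 1 / sqrt T"
  define z where "z = y / sqrt s"
  have s: "s > 0" and c2: "c2 > 0" using assms by simp_all
  have v_less: "v < alpha" using assms(3) by (simp add: v_def)
  have v: "(alpha * sqrt T - 1) / sqrt T = v"
    using assms(3) by (simp add: v_def field_simps)
  have "(alpha * sqrt T - 1) / T = v / sqrt T"
    using assms(3) by (simp add: v[symmetric])
  then have "h c2 1 v = v"
    using assms(3,5) h_scale[OF c2 assms(3), of "alpha * sqrt T - 1"] v by simp
  then have hv: "h c 1 v \<le> v"
    using h_le_id assms(1,2) v_less by blast
  \<comment> \<open>The strip of height 1 below the boundary has scaled width
    \<open>1 / sqrt s\<close>, so for \<open>s >= T\<close> it stays between \<open>v\<close> and
    \<open>alpha\<close>.\<close>
  have "1 / sqrt s \<le> 1 / sqrt T"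
    using assms(3,4) by (simp add: frac_le)
  then have z: "v \<le> z" "z \<le> alpha"
    using assms(6,7) s by (auto simp: v_def z_def field_simps)
  define r where "r = (z - v) / (alpha - v)"
  have r: "0 \<le> r" "r \<le> 1" using z v_less by (simp_all add: r_def)
  have zr: "z = (1 - r) * v + r * alpha"
  proof -
    have "r * (alpha - v) = z - v" using v_less by (simp add: r_def)
    then show ?thesis by (simp add: algebra_simps)
  qed
  have "h c 1 z \<le> (1 - r) * h c 1 v + r * h c 1 alpha"
    unfolding zr by (rule h_convex[OF assms(1) _ r]) simp
  also have "\<dots> \<le> (1 - r) * v + r * alpha"
    using hv r h_alpha[OF assms(1)] by (auto intro: mult_left_mono)
  finally have "h c 1 z \<le> z" using zr by simp
  then have "h c s y \<le> z / sqrt s"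
    using s by (simp add: h_scale[OF assms(1) s, of y] z_def[symmetric] divide_right_mono)
  also have "\<dots> = y / s" using s by (simp add: z_def)
  finally show ?thesis .
qed

section \<open>Stopping the walk\<close>

locale bernoulli_walk = prob_space M
  for M :: "'a measure" and X :: "nat \<Rightarrow> 'a \<Rightarrow> real" +
  assumes steps: "symmetric_bernoulli_steps M X"
begin

abbreviation S :: "nat \<Rightarrow> 'a \<Rightarrow> real" where "S \<equiv> walk X"

lemma S_0 [simp]: "S 0 \<omega> = 0"
  by (simp add: walk_def)

lemma S_Suc: "S (Suc n) \<omega> = S n \<omega> + X (Suc n) \<omega>"
  by (simp add: walk_def)

lemma indep_steps: "indep_vars (\<lambda>_. borel) X {1..}"
  using steps by (simp add: symmetric_bernoulli_steps_def)

lemma prob_step: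
  "i \<ge> 1 \<Longrightarrow> prob {\<omega> \<in> space M. X i \<omega> = 1} = 1 / 2"
  "i \<ge> 1 \<Longrightarrow> prob {\<omega> \<in> space M. X i \<omega> = - 1} = 1 / 2"
  using steps by (simp_all add: symmetric_bernoulli_steps_def)

lemma measurable_step: "i \<ge> 1 \<Longrightarrow> X i \<in> borel_measurable M"
  using indep_steps by (auto simp: indep_vars_def)

lemma measurable_S [measurable]: "S n \<in> borel_measurable M"
  unfolding walk_def[abs_def] by (intro borel_measurable_sum) (auto intro: measurable_step)

lemma AE_steps: "AE \<omega> in M. \<forall>i\<ge>1. X i \<omega> = 1 \<or> X i \<omega> = - 1"
proof (subst AE_all_countable, intro allI)
  fix i
  show "AE \<omega> in M. 1 \<le> i \<longrightarrow> X i \<omega> = 1 \<or> X i \<omega> = - 1"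
  proof (cases "i \<ge> 1")
    case True
    note [measurable] = measurable_step[OF True]
    have "prob ({\<omega> \<in> space M. X i \<omega> = 1} \<union> {\<omega> \<in> space M. X i \<omega> = - 1})
        = prob {\<omega> \<in> space M. X i \<omega> = 1} + prob {\<omega> \<in> space M. X i \<omega> = - 1}"
      by (rule finite_measure_Union) auto
    also have "\<dots> = 1 / 2 + 1 / 2"
      by (simp only: prob_step[OF True])
    also have "{\<omega> \<in> space M. X i \<omega> = 1} \<union> {\<omega> \<in> space M. X i \<omega> = - 1}
        = {\<omega> \<in> space M. X i \<omega> = 1 \<or> X i \<omega> = - 1}"
      by auto
    finally have "prob {\<omega> \<in> space M. X i \<omega> = 1 \<or> X i \<omega> = - 1} = 1" by simp
    then have "AE \<omega> in M. X i \<omega> = 1 \<or> X i \<omega> = - 1"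
      by (subst (asm) prob_Collect_eq_1) auto
    then show ?thesis by simp
  qed simp
qed

lemma AE_S_bound: "AE \<omega> in M. \<forall>n. \<bar>S n \<omega>\<bar> \<le> real n"
  using AE_steps
proof eventually_elim
  case (elim \<omega>)
  show ?case
  proof
    fix n show "\<bar>S n \<omega>\<bar> \<le> real n"
    proof (induction n)
      case (Suc n)
      have "X (Suc n) \<omega> = 1 \<or> X (Suc n) \<omega> = - 1" using elim by simp
      then show ?case using Suc by (auto simp: S_Suc)
    qed simp
  qed
qed

section \<open>One-step expectations of the walk restricted to its past\<close>

definition stays :: "(nat \<Rightarrow> real set) \<Rightarrow> nat \<Rightarrow> 'a \<Rightarrow> real" where
  "stays B n \<omega> = (if \<forall>k\<le>n. S k \<omega> \<in> B k then 1 else 0)"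

lemma measurable_stays:
  assumes "\<And>k. B k \<in> sets borel"
  shows "stays B n \<in> borel_measurable M"
proof -
  note [measurable] = assms
  show ?thesis unfolding stays_def[abs_def] by measurable
qed

text \<open>Since \<open>S m\<close> almost surely lies within distance \<open>m\<close> of 0, a
  bound for \<open>f\<close> on that range is enough; this admits \<open>h\<close>, which is
  unbounded in space.\<close>

lemma integrable_stays:
  assumes "\<And>k. B k \<in> sets borel" "f \<in> borel_measurable borel"
    and "\<And>y. \<bar>y\<bar> \<le> real m \<Longrightarrow> \<bar>f y\<bar> \<le> C"
  shows "integrable M (\<lambda>\<omega>. stays B n \<omega> * f (S m \<omega>))"
proof (rule integrable_const_bound)
  note [measurable] = measurable_stays[OF assms(1)] assms(2)
  show "AE \<omega> in M. norm (stays B n \<omega> * f (S m \<omega>)) \<le> C"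
    using AE_S_bound
  proof eventually_elim
    case (elim \<omega>)
    then have "\<bar>f (S m \<omega>)\<bar> \<le> C" using assms(3) by blast
    then show ?case by (auto simp: stays_def)
  qed
  show "(\<lambda>\<omega>. stays B n \<omega> * f (S m \<omega>)) \<in> borel_measurable M"
    by measurable
qed

text \<open>A function of the first \<open>n\<close> steps is independent of the next one, so the
  expectation of the product factors.\<close>

lemma expectation_path_step:
  fixes G :: "(nat \<Rightarrow> real) \<Rightarrow> real"
  assumes G: "G \<in> borel_measurable (Pi\<^sub>M {1..n} (\<lambda>_. borel))"
    and int: "integrable M (\<lambda>\<omega>. G (\<lambda>i\<in>{1..n}. X i \<omega>))"
    and e: "e = 1 \<or> e = - 1"
  shows "integrable M (\<lambda>\<omega>. G (\<lambda>i\<in>{1..n}. X i \<omega>) * indicator {e} (X (Suc n) \<omega>))"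
    and "expectation (\<lambda>\<omega>. G (\<lambda>i\<in>{1..n}. X i \<omega>) * indicator {e} (X (Suc n) \<omega>))
      = 1 / 2 * expectation (\<lambda>\<omega>. G (\<lambda>i\<in>{1..n}. X i \<omega>))"
proof -
  note [measurable] = measurable_step[of "Suc n", simplified]
  define U where "U = (\<lambda>\<omega>. indicator {e} (X (Suc n) \<omega>) :: real)"
  have "indep_var (Pi\<^sub>M {1..n} (\<lambda>_. borel)) (\<lambda>\<omega>. \<lambda>i\<in>{1..n}. X i \<omega>)
      (Pi\<^sub>M {Suc n} (\<lambda>_. borel)) (\<lambda>\<omega>. \<lambda>i\<in>{Suc n}. X i \<omega>)"
    by (rule indep_var_restrict[OF indep_steps]) auto
  from indep_var_compose[OF this G, of "\<lambda>p. indicator {e} (p (Suc n)) :: real" borel]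
  have ind: "indep_var borel (\<lambda>\<omega>. G (\<lambda>i\<in>{1..n}. X i \<omega>)) borel U"
    by (simp add: o_def U_def)
  have U: "integrable M U"
    unfolding U_def by (rule integrable_const_bound[of _ 1]) (auto simp: indicator_def)
  have "expectation U = prob {\<omega> \<in> space M. X (Suc n) \<omega> = e}"
  proof -
    have "expectation U = expectation (indicator {\<omega> \<in> space M. X (Suc n) \<omega> = e})"
      by (rule Bochner_Integration.integral_cong) (auto simp: U_def indicator_def)
    then show ?thesis by simp
  qed
  also have "\<dots> = 1 / 2"
    using e prob_step[of "Suc n"] by auto
  finally have EU: "expectation U = 1 / 2" .
  show "integrable M (\<lambda>\<omega>. G (\<lambda>i\<in>{1..n}. X i \<omega>) * indicator {e} (X (Suc n) \<omega>))"
    using indep_var_integrable[OF ind int U] by (simp add: U_def)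
  show "expectation (\<lambda>\<omega>. G (\<lambda>i\<in>{1..n}. X i \<omega>) * indicator {e} (X (Suc n) \<omega>))
      = 1 / 2 * expectation (\<lambda>\<omega>. G (\<lambda>i\<in>{1..n}. X i \<omega>))"
    using indep_var_lebesgue_integral[OF ind int U] EU by (simp add: U_def)
qed

text \<open>The Markov property in integrated form: the expectation is split according to the value
  of the next step, and each half is evaluated by independence.\<close>

lemma expectation_stays_step:
  assumes B: "\<And>k. B k \<in> sets borel" and f: "f \<in> borel_measurable borel"
    and bound: "\<And>y. \<bar>y\<bar> \<le> real (Suc n) \<Longrightarrow> \<bar>f y\<bar> \<le> C"
  shows "expectation (\<lambda>\<omega>. stays B n \<omega> * f (S (Suc n) \<omega>))
      = expectation (\<lambda>\<omega>. stays B n \<omega> * (1 / 2 * (f (S n \<omega> - 1) + f (S n \<omega> + 1))))"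
proof -
  note [measurable] = B f measurable_stays[OF B] measurable_step[of "Suc n", simplified]
  define W where "W e \<omega> = stays B n \<omega> * f (S n \<omega> + e)" for e \<omega>
  have int: "integrable M (W e)" if "e = 1 \<or> e = - 1" for e
    unfolding W_def[abs_def]
    by (rule integrable_stays[where C = C]) (use that B in \<open>auto intro!: bound\<close>)
  have step: "integrable M (\<lambda>\<omega>. W e \<omega> * indicator {e} (X (Suc n) \<omega>))
     \<and> expectation (\<lambda>\<omega>. W e \<omega> * indicator {e} (X (Suc n) \<omega>)) = 1 / 2 * expectation (W e)"
    if e: "e = 1 \<or> e = - 1" for e
  proof -
    \<comment> \<open>Independence is available for the steps, so \<open>W e\<close> is rewritten as
      a function of the steps instead of the partial sums.\<close>
    define G where "G p = (if \<forall>k\<le>n. (\<Sum>i=1..k. p i) \<in> B k then 1 else 0) * f ((\<Sum>i=1..n. p i) + e)"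
      for p :: "nat \<Rightarrow> real"
    have sum_meas: "(\<lambda>p. \<Sum>i=1..k. p i :: real) \<in> borel_measurable (Pi\<^sub>M {1..n} (\<lambda>_. borel))" if "k \<le> n" for k
      using that by (intro borel_measurable_sum[of "{1..k}" "\<lambda>i p. p i :: real"] measurable_component_singleton) auto
    have "G = (\<lambda>p. (\<Prod>k\<le>n. indicator (B k) (\<Sum>i=1..k. p i)) * f ((\<Sum>i=1..n. p i) + e))"
      by (auto simp: G_def fun_eq_iff indicator_def prod_zero_iff intro!: prod.neutral)
    moreover have "\<dots> \<in> borel_measurable (Pi\<^sub>M {1..n} (\<lambda>_. borel))"
    proof (intro borel_measurable_times borel_measurable_prod)
      show "(\<lambda>p. indicator (B k) (\<Sum>i=1..k. p i) :: real) \<in> borel_measurable (Pi\<^sub>M {1..n} (\<lambda>_. borel))"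
        if "k \<in> {..n}" for k
        using that by (intro measurable_compose[OF sum_meas]) auto
      show "(\<lambda>p. f ((\<Sum>i=1..n. p i) + e)) \<in> borel_measurable (Pi\<^sub>M {1..n} (\<lambda>_. borel))"
        by (intro measurable_compose[OF sum_meas]) auto
    qed
    ultimately have Gm: "G \<in> borel_measurable (Pi\<^sub>M {1..n} (\<lambda>_. borel))"
      by simp
    have "(\<Sum>i=1..k. restrict (\<lambda>i. X i \<omega>) {1..n} i) = S k \<omega>" if "k \<le> n" for k \<omega>
      unfolding walk_def using that by (intro sum.cong) auto
    then have GW: "G (\<lambda>i\<in>{1..n}. X i \<omega>) = W e \<omega>" for \<omega>
      by (auto simp: G_def W_def stays_def)
    show ?thesis
      by (intro conjI expectation_path_step[OF Gm, unfolded GW] int e)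
  qed
  have "expectation (\<lambda>\<omega>. stays B n \<omega> * f (S (Suc n) \<omega>))
      = expectation (\<lambda>\<omega>. W (- 1) \<omega> * indicator {- 1} (X (Suc n) \<omega>)
          + W 1 \<omega> * indicator {1} (X (Suc n) \<omega>))"
  proof (rule integral_cong_AE)
    show "AE \<omega> in M. stays B n \<omega> * f (S (Suc n) \<omega>)
      = W (- 1) \<omega> * indicator {- 1} (X (Suc n) \<omega>) + W 1 \<omega> * indicator {1} (X (Suc n) \<omega>)"
      using AE_steps
    proof eventually_elim
      case (elim \<omega>)
      then have "X (Suc n) \<omega> = 1 \<or> X (Suc n) \<omega> = - 1" by simp
      then show ?case by (auto simp: W_def S_Suc)
    qed
  qed (unfold W_def[abs_def], measurable)
  also have "\<dots> = 1 / 2 * expectation (W (- 1)) + 1 / 2 * expectation (W 1)"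
    using step[of "- 1"] step[of 1] by (subst Bochner_Integration.integral_add) auto
  also have "\<dots> = expectation (\<lambda>\<omega>. 1 / 2 * W (- 1) \<omega> + 1 / 2 * W 1 \<omega>)"
    using int[of "- 1"] int[of 1] by (subst Bochner_Integration.integral_add) auto
  also have "\<dots> = expectation (\<lambda>\<omega>. stays B n \<omega> * (1 / 2 * (f (S n \<omega> - 1) + f (S n \<omega> + 1))))"
    by (rule Bochner_Integration.integral_cong) (simp_all add: W_def algebra_simps)
  finally show ?thesis .
qed

section \<open>Moments of the walk\<close>

lemma integrable_S:
  fixes f :: "real \<Rightarrow> real"
  assumes "f \<in> borel_measurable borel" "\<And>y. \<bar>y\<bar> \<le> real n \<Longrightarrow> \<bar>f y\<bar> \<le> C"
  shows "integrable M (\<lambda>\<omega>. f (S n \<omega>))"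
  using integrable_stays[of "\<lambda>_. UNIV" f n C 0] assms by (simp add: stays_def)

lemma integrable_S_square: "integrable M (\<lambda>\<omega>. (S n \<omega>)\<^sup>2)"
  by (rule integrable_S[where C = "(real n)\<^sup>2"]) (auto simp: abs_le_square_iff[symmetric])

lemma expectation_S_square: "expectation (\<lambda>\<omega>. (S n \<omega>)\<^sup>2) = real n"
proof (induction n)
  case (Suc n)
  have "expectation (\<lambda>\<omega>. (S (Suc n) \<omega>)\<^sup>2)
      = expectation (\<lambda>\<omega>. 1 / 2 * ((S n \<omega> - 1)\<^sup>2 + (S n \<omega> + 1)\<^sup>2))"
    using expectation_stays_step[of "\<lambda>_. UNIV" "\<lambda>y. y\<^sup>2" n "(real (Suc n))\<^sup>2"]
    by (simp add: stays_def abs_le_square_iff[symmetric])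
  also have "\<dots> = expectation (\<lambda>\<omega>. (S n \<omega>)\<^sup>2 + 1)"
    by (rule Bochner_Integration.integral_cong) (simp_all add: power2_eq_square algebra_simps)
  also have "\<dots> = real (Suc n)"
    using Suc by (subst Bochner_Integration.integral_add) (auto simp: integrable_S_square prob_space)
  finally show ?case .
qed simp

lemma integrable_abs_S: "integrable M (\<lambda>\<omega>. \<bar>S n \<omega>\<bar>)"
  by (rule integrable_S[where C = "real n"]) auto

text \<open>With \<open>r = sqrt n\<close>, expanding \<open>(\<bar>S n\<bar> - r)^2 >= 0\<close>
  bounds the absolute value by a multiple of the square plus \<open>r / 2\<close>; the second moment
  then contributes the other \<open>r / 2\<close>.\<close>

lemma expectation_abs_S: "expectation (\<lambda>\<omega>. \<bar>S n \<omega>\<bar>) \<le> sqrt (real n)"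
proof (cases "n = 0")
  case False
  define r where "r = sqrt (real n)"
  have r: "r > 0" "r * r = real n" using False by (simp_all add: r_def)
  have "expectation (\<lambda>\<omega>. \<bar>S n \<omega>\<bar>) \<le> expectation (\<lambda>\<omega>. (S n \<omega>)\<^sup>2 * (1 / (2 * r)) + r / 2)"
  proof (rule integral_mono)
    fix \<omega>
    have "0 \<le> (\<bar>S n \<omega>\<bar> - r)\<^sup>2" by simp
    then have "\<bar>S n \<omega>\<bar> * (2 * r) \<le> (S n \<omega>)\<^sup>2 + r * r"
      by (simp add: power2_diff power2_eq_square algebra_simps)
    then show "\<bar>S n \<omega>\<bar> \<le> (S n \<omega>)\<^sup>2 * (1 / (2 * r)) + r / 2"
      using r(1) by (simp add: field_simps)
  qed (auto simp: integrable_abs_S integrable_S_square)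
  also have "\<dots> = real n * (1 / (2 * r)) + r / 2"
    by (subst Bochner_Integration.integral_add)
       (auto simp: integrable_S_square expectation_S_square prob_space)
  also have "\<dots> = r" using r by (simp add: field_simps flip: r(2))
  finally show ?thesis by (simp add: r_def)
qed simp

section \<open>Truncated hitting times and optional stopping\<close>

text \<open>The alternative \<open>N <= k\<close> truncates at \<open>N\<close> and guarantees that
  the least element exists on every path.\<close>

definition hit :: "(nat \<Rightarrow> real) \<Rightarrow> nat \<Rightarrow> 'a \<Rightarrow> nat" where
  "hit b N \<omega> = (LEAST k. N \<le> k \<or> b k \<le> S k \<omega>)"

lemma hit_le: "hit b N \<omega> \<le> N"
  unfolding hit_def by (rule Least_le) simp

lemma hit_stopped: "N \<le> hit b N \<omega> \<or> b (hit b N \<omega>) \<le> S (hit b N \<omega>) \<omega>"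
  unfolding hit_def by (rule LeastI2_wellorder[where a = N]) auto

lemma before_hit: "k < hit b N \<omega> \<Longrightarrow> S k \<omega> < b k"
  using not_less_Least[of k] unfolding hit_def by fastforce

lemma hit_eqI: "N \<le> k \<or> b k \<le> S k \<omega> \<Longrightarrow> (\<And>j. j < k \<Longrightarrow> j < N \<and> S j \<omega> < b j) \<Longrightarrow> hit b N \<omega> = k"
  unfolding hit_def by (rule Least_equality) (auto simp: not_le[symmetric])

lemma hit_Suc:
  "hit b (Suc N) \<omega> = (if \<forall>k\<le>N. S k \<omega> < b k then Suc N else hit b N \<omega>)"
proof (cases "\<forall>k\<le>N. S k \<omega> < b k")
  case True
  then have "hit b (Suc N) \<omega> = Suc N"
    by (intro hit_eqI) auto
  then show ?thesis using True by simp
next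
  case False
  then have "b (hit b N \<omega>) \<le> S (hit b N \<omega>) \<omega>"
    using hit_stopped[of N b \<omega>] hit_le[of b N \<omega>] before_hit[of _ b N \<omega>]
    by (metis le_antisym le_neq_implies_less not_le)
  then have "hit b (Suc N) \<omega> = hit b N \<omega>"
    using hit_le[of b N \<omega>] before_hit[of _ b N \<omega>] by (intro hit_eqI) auto
  then show ?thesis by (simp only: False if_False)
qed

lemma hit_all_before: "hit b N \<omega> = N \<longleftrightarrow> (\<forall>k<N. S k \<omega> < b k)"
  using before_hit[of _ b N \<omega>] by (metis hit_eqI order_refl)

text \<open>Telescoping along the stopped path: the indicator \<open>stays\<close> at
  \<open>n\<close> retains the increment from \<open>n\<close> to \<open>n + 1\<close> exactly when
  the walk has not reached \<open>b\<close> up to time \<open>n\<close>.\<close>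

lemma stopped_eq:
  "u (hit b N \<omega>) (S (hit b N \<omega>) \<omega>)
    = u 0 0 + (\<Sum>n<N. stays (\<lambda>k. {..<b k}) n \<omega> * (u (Suc n) (S (Suc n) \<omega>) - u n (S n \<omega>)))"
proof (induction N)
  case 0
  have "hit b 0 \<omega> = 0" using hit_le[of b 0 \<omega>] by simp
  then show ?case by simp
next
  case (Suc N)
  have "hit b N \<omega> = N" if "\<forall>k\<le>N. S k \<omega> < b k"
    using that by (simp add: hit_all_before)
  then show ?case using Suc by (auto simp: hit_Suc stays_def)
qed

context
  fixes u :: "nat \<Rightarrow> real \<Rightarrow> real" and b :: "nat \<Rightarrow> real" and C :: "nat \<Rightarrow> real"
  assumes u_meas: "\<And>n. u n \<in> borel_measurable borel"
    and u_bound: "\<And>n y. \<bar>y\<bar> \<le> real n \<Longrightarrow> \<bar>u n y\<bar> \<le> C n"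
begin

lemma integrable_increment:
  "integrable M (\<lambda>\<omega>. stays (\<lambda>k. {..<b k}) n \<omega> * (u (Suc n) (S (Suc n) \<omega>) - u n (S n \<omega>)))"
proof -
  have "integrable M (\<lambda>\<omega>. stays (\<lambda>k. {..<b k}) n \<omega> * u m (S m \<omega>))" for m
    by (rule integrable_stays[where C = "C m"]) (auto intro: u_meas u_bound)
  then show ?thesis by (simp add: right_diff_distrib)
qed

lemma integrable_stopped: "integrable M (\<lambda>\<omega>. u (hit b N \<omega>) (S (hit b N \<omega>) \<omega>))"
  unfolding stopped_eq
  by (intro Bochner_Integration.integrable_add Bochner_Integration.integrable_sum integrable_const
      integrable_increment)

text \<open>Optional stopping for a submartingale: each increment in \<open>stopped_eq\<close> has
  nonnegative expectation. The one-step inequality below \<open>b\<close> suffices, as the indicator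
  vanishes elsewhere.\<close>

lemma expectation_stopped_ge:
  assumes "\<And>n y. y < b n \<Longrightarrow> u n y \<le> 1 / 2 * (u (Suc n) (y - 1) + u (Suc n) (y + 1))"
  shows "u 0 0 \<le> expectation (\<lambda>\<omega>. u (hit b N \<omega>) (S (hit b N \<omega>) \<omega>))"
proof -
  have "0 \<le> expectation (\<lambda>\<omega>. stays (\<lambda>k. {..<b k}) n \<omega> * (u (Suc n) (S (Suc n) \<omega>) - u n (S n \<omega>)))"
    (is "0 \<le> expectation ?D") for n
  proof -
    let ?I = "stays (\<lambda>k. {..<b k}) n"
    have i1: "integrable M (\<lambda>\<omega>. ?I \<omega> * u m (S m \<omega>))" for m
      by (rule integrable_stays[where C = "C m"]) (auto intro: u_meas u_bound)
    have i2: "integrable M (\<lambda>\<omega>. ?I \<omega> * (1 / 2 * (u (Suc n) (S n \<omega> - 1) + u (Suc n) (S n \<omega> + 1))))"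
    proof (rule integrable_stays[where C = "C (Suc n)"])
      note [measurable] = u_meas
      show "(\<lambda>y. 1 / 2 * (u (Suc n) (y - 1) + u (Suc n) (y + 1))) \<in> borel_measurable borel"
        by measurable
      fix y :: real assume "\<bar>y\<bar> \<le> real n"
      then have "\<bar>u (Suc n) (y - 1)\<bar> \<le> C (Suc n)" "\<bar>u (Suc n) (y + 1)\<bar> \<le> C (Suc n)"
        by (auto intro!: u_bound)
      then show "\<bar>1 / 2 * (u (Suc n) (y - 1) + u (Suc n) (y + 1))\<bar> \<le> C (Suc n)"
        by simp
    qed simp
    have "expectation ?D = expectation (\<lambda>\<omega>. ?I \<omega> * u (Suc n) (S (Suc n) \<omega>)) - expectation (\<lambda>\<omega>. ?I \<omega> * u n (S n \<omega>))"
      unfolding right_diff_distrib by (rule Bochner_Integration.integral_diff[OF i1 i1])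
    also have "expectation (\<lambda>\<omega>. ?I \<omega> * u (Suc n) (S (Suc n) \<omega>))
        = expectation (\<lambda>\<omega>. ?I \<omega> * (1 / 2 * (u (Suc n) (S n \<omega> - 1) + u (Suc n) (S n \<omega> + 1))))"
      by (rule expectation_stays_step[where C = "C (Suc n)"]) (auto intro: u_meas u_bound)
    finally have "expectation ?D = expectation (\<lambda>\<omega>. ?I \<omega> * (1 / 2 * (u (Suc n) (S n \<omega> - 1) + u (Suc n) (S n \<omega> + 1))))
        - expectation (\<lambda>\<omega>. ?I \<omega> * u n (S n \<omega>))" .
    moreover have "expectation (\<lambda>\<omega>. ?I \<omega> * u n (S n \<omega>)) \<le> expectation (\<lambda>\<omega>. ?I \<omega> * (1 / 2 * (u (Suc n) (S n \<omega> - 1) + u (Suc n) (S n \<omega> + 1))))"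
      by (rule integral_mono[OF i1 i2]) (use assms[of _ n] in \<open>simp add: stays_def\<close>)
    ultimately show ?thesis by simp
  qed
  then show ?thesis
    unfolding stopped_eq
    by (subst Bochner_Integration.integral_add)
       (auto simp: prob_space Bochner_Integration.integral_sum integrable_increment intro!: sum_nonneg)
qed

end

text \<open>For \<open>j < N\<close>, stopping by time \<open>j\<close> means that some
  \<open>S k\<close> with \<open>k <= j\<close> has reached \<open>b k\<close>; from
  \<open>N\<close> on the event is the whole space.\<close>

lemma hit_stopping_time: "(\<lambda>\<omega>. enat (hit b N \<omega>)) \<in> stopping_times M X"
proof -
  have "Measurable.pred (walk_filtration M X m) (\<lambda>\<omega>. enat (hit b N \<omega>) \<le> m)" for m
  proof (cases "enat N \<le> m")
    case True
    then have "enat (hit b N \<omega>) \<le> m" for \<omega>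
      using hit_le[of b N \<omega>] by (meson enat_ord_simps(1) order_trans)
    then show ?thesis by simp
  next
    case False
    then obtain j where m: "m = enat j" and j: "j < N"
      by (cases m) auto
    let ?G = "{S k -` A \<inter> space M | k A. enat k \<le> m \<and> A \<in> sets borel}"
    have G: "?G \<subseteq> Pow (space M)" by auto
    have eq: "{\<omega> \<in> space M. enat (hit b N \<omega>) \<le> m} = (\<Union>k\<le>j. S k -` {b k..} \<inter> space M)"
    proof (intro set_eqI iffI)
      fix \<omega> assume "\<omega> \<in> {\<omega> \<in> space M. enat (hit b N \<omega>) \<le> m}"
      then show "\<omega> \<in> (\<Union>k\<le>j. S k -` {b k..} \<inter> space M)"
        using hit_stopped[of N b \<omega>] j by (auto simp: m)
    next
      fix \<omega> assume "\<omega> \<in> (\<Union>k\<le>j. S k -` {b k..} \<inter> space M)"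
      then obtain k where "k \<le> j" "b k \<le> S k \<omega>" "\<omega> \<in> space M" by auto
      then show "\<omega> \<in> {\<omega> \<in> space M. enat (hit b N \<omega>) \<le> m}"
        using before_hit[of k b N \<omega>] by (force simp: m)
    qed
    have "(\<Union>k\<le>j. S k -` {b k..} \<inter> space M) \<in> sets (sigma (space M) ?G)"
    proof (rule sets.finite_UN)
      fix k assume "k \<in> {..j}"
      then have "S k -` {b k..} \<inter> space M \<in> ?G"
        by (auto simp: m intro!: exI[of _ k] exI[of _ "{b k..}"])
      then show "S k -` {b k..} \<inter> space M \<in> sets (sigma (space M) ?G)"
        using G by (simp add: sets_measure_of sigma_sets.Basic)
    qed simp
    then show ?thesis
      using eq G by (simp add: pred_def walk_filtration_def space_measure_of)
  qed
  then show ?thesis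
    by (simp add: stopping_times_def stopping_time_def)
qed

section \<open>Payoffs and the value function\<close>

lemma payoff_bound:
  assumes "t > 0" "\<bar>y\<bar> \<le> real k"
  shows "\<bar>(x + y) / (t + real k)\<bar> \<le> \<bar>x\<bar> / t + 1"
proof -
  have "\<bar>x + y\<bar> \<le> \<bar>x\<bar> + real k" using assms(2) by linarith
  also have "\<dots> \<le> (\<bar>x\<bar> / t + 1) * (t + real k)"
    using assms(1) by (simp add: field_simps)
  finally show ?thesis
    using assms(1) by (simp add: abs_divide divide_le_eq)
qed

text \<open>A supremum in the reals dominates its members only if the family is bounded above, and
  \<open>payoff_bound\<close> provides such a bound uniformly in the stopping time.\<close>

lemma value_fun_upper:
  assumes "t > 0" "\<tau> \<in> stopping_times M X"
  shows "expectation (\<lambda>\<omega>. (x + S (the_enat (\<tau> \<omega>)) \<omega>) / (t + real (the_enat (\<tau> \<omega>)))) \<le> value_fun M X t x"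
  unfolding value_fun_def
proof (rule cSUP_upper[OF assms(2)])
  show "bdd_above ((\<lambda>\<tau>. expectation (\<lambda>\<omega>. (x + S (the_enat (\<tau> \<omega>)) \<omega>) / (t + real (the_enat (\<tau> \<omega>)))))
      ` stopping_times M X)"
  proof (rule bdd_aboveI2[where M = "\<bar>x\<bar> / t + 1"])
    fix \<tau> :: "'a \<Rightarrow> enat"
    let ?f = "\<lambda>\<omega>. (x + S (the_enat (\<tau> \<omega>)) \<omega>) / (t + real (the_enat (\<tau> \<omega>)))"
    show "expectation ?f \<le> \<bar>x\<bar> / t + 1"
    proof (cases "integrable M ?f")
      case True
      have "AE \<omega> in M. ?f \<omega> \<le> \<bar>x\<bar> / t + 1"
        using AE_S_bound
      proof eventually_elim
        case (elim \<omega>)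
        then show ?case
          using payoff_bound[OF assms(1), of "S (the_enat (\<tau> \<omega>)) \<omega>" "the_enat (\<tau> \<omega>)" x]
          by (meson abs_le_D1)
      qed
      then have "expectation ?f \<le> expectation (\<lambda>_. \<bar>x\<bar> / t + 1)"
        using True by (intro integral_mono_AE) auto
      then show ?thesis by (simp add: prob_space)
    next
      \<comment> \<open>A non-integrable function has integral 0 by convention, and the bound is
        nonnegative.\<close>
      case False
      then show ?thesis
        using assms(1) by (simp add: not_integrable_integral_eq)
    qed
  qed
qed

text \<open>Stopping one unit below the boundary \<open>\<beta>\<close> keeps the walk from overshooting it, which is
  where \<open>H\<close> is compared with the payoff.\<close>

lemma value_fun_lower_bound:
  fixes H :: "real \<Rightarrow> real \<Rightarrow> real" and \<beta> :: "real \<Rightarrow> real"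
  assumes t: "t > 0" and x: "x \<le> \<beta> t"
    and \<beta>_mono: "\<And>r s. t \<le> r \<Longrightarrow> r \<le> s \<Longrightarrow> \<beta> r \<le> \<beta> s"
    and H_mono: "\<And>s y z. t \<le> s \<Longrightarrow> y \<le> z \<Longrightarrow> H s y \<le> H s z"
    and H_nonneg: "\<And>s y. t \<le> s \<Longrightarrow> 0 \<le> H s y"
    and H_sub: "\<And>s y. t \<le> s \<Longrightarrow> y \<le> \<beta> s - 1 \<Longrightarrow> H s y \<le> 1 / 2 * (H (s + 1) (y - 1) + H (s + 1) (y + 1))"
    and H_le: "\<And>s y. t \<le> s \<Longrightarrow> \<beta> s - 1 \<le> y \<Longrightarrow> y \<le> \<beta> s \<Longrightarrow> H s y \<le> y / s"
    and H_lim: "(\<lambda>n. H (t + real n) (\<beta> (t + real n))) \<longlonglongrightarrow> 0"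
  shows "H t x \<le> value_fun M X t x"
proof -
  define b where "b n = \<beta> (t + real n) - 1 - x" for n
  define u where "u n y = H (t + real n) (x + y)" for n y
  define g where "g n y = (x + y) / (t + real n)" for n and y :: real
  \<comment> \<open>Monotonicity in space gives measurability; together with nonnegativity it also
    makes \<open>u n (real n)\<close> a bound on the reachable range.\<close>
  have u_meas: "u n \<in> borel_measurable borel" for n
    by (rule borel_measurable_mono) (auto simp: u_def mono_def intro: H_mono)
  have u_bound: "\<bar>u n y\<bar> \<le> u n (real n)" if "\<bar>y\<bar> \<le> real n" for n y
    using H_nonneg[of "t + real n" "x + y"] that by (simp add: u_def H_mono)
  have g_meas: "g n \<in> borel_measurable borel" for n
    unfolding g_def[abs_def] by measurable
  have g_bound: "\<bar>g n y\<bar> \<le> \<bar>x\<bar> / t + 1" if "\<bar>y\<bar> \<le> real n" for n y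
    unfolding g_def by (rule payoff_bound[OF t that])
  \<comment> \<open>Before stopping, the walk is more than 1 below the boundary; one step adds at
    most 1 and the boundary does not decrease. Stopping at time 0 is covered by the premise on
    \<open>x\<close>.\<close>
  have below: "AE \<omega> in M. \<forall>N. x + S (hit b N \<omega>) \<omega> \<le> \<beta> (t + real (hit b N \<omega>))"
    using AE_steps
  proof eventually_elim
    case (elim \<omega>)
    show ?case
    proof
      fix N
      show "x + S (hit b N \<omega>) \<omega> \<le> \<beta> (t + real (hit b N \<omega>))"
      proof (cases "hit b N \<omega>")
        case (Suc k)
        then have "S k \<omega> < b k" by (intro before_hit[of k b N]) simp
        moreover have "X (Suc k) \<omega> \<le> 1" using elim[rule_format, of "Suc k"] by auto
        moreover have "\<beta> (t + real k) \<le> \<beta> (t + real (Suc k))" by (rule \<beta>_mono) auto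
        ultimately show ?thesis unfolding Suc S_Suc b_def by simp
      qed (use x in simp)
    qed
  qed
  \<comment> \<open>The truncation error: the first term bounds \<open>H\<close> on paths not
    stopped before \<open>N\<close>, the second offsets a possibly negative payoff there, with
    \<open>sqrt N\<close> bounding the mean of the absolute value of \<open>S N\<close>.\<close>
  define r where "r N = H (t + real N) (\<beta> (t + real N)) + (\<bar>x\<bar> + sqrt (real N)) / (t + real N)" for N
  have main: "H t x \<le> value_fun M X t x + r N" for N
  proof -
    let ?e = "\<lambda>\<omega>. H (t + real N) (\<beta> (t + real N)) + (\<bar>x\<bar> + \<bar>S N \<omega>\<bar>) / (t + real N)"
    have ie: "integrable M ?e" by (simp add: integrable_abs_S)
    have ig: "integrable M (\<lambda>\<omega>. g (hit b N \<omega>) (S (hit b N \<omega>) \<omega>))"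
      by (rule integrable_stopped[OF g_meas g_bound])
    have "H t x = u 0 0" by (simp add: u_def)
    also have "u 0 0 \<le> expectation (\<lambda>\<omega>. u (hit b N \<omega>) (S (hit b N \<omega>) \<omega>))"
    proof (rule expectation_stopped_ge[OF u_meas u_bound])
      fix n y assume "y < b n"
      then show "u n y \<le> 1 / 2 * (u (Suc n) (y - 1) + u (Suc n) (y + 1))"
        using H_sub[of "t + real n" "x + y"] by (simp add: u_def b_def algebra_simps)
    qed
    also have "\<dots> \<le> expectation (\<lambda>\<omega>. g (hit b N \<omega>) (S (hit b N \<omega>) \<omega>) + ?e \<omega>)"
    proof (rule integral_mono_AE)
      show "integrable M (\<lambda>\<omega>. u (hit b N \<omega>) (S (hit b N \<omega>) \<omega>))"
        by (rule integrable_stopped[OF u_meas u_bound])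
      show "AE \<omega> in M. u (hit b N \<omega>) (S (hit b N \<omega>) \<omega>) \<le> g (hit b N \<omega>) (S (hit b N \<omega>) \<omega>) + ?e \<omega>"
        using below
      proof eventually_elim
        case (elim \<omega>)
        let ?k = "hit b N \<omega>"
        have le: "x + S ?k \<omega> \<le> \<beta> (t + real ?k)" using elim by blast
        have H0: "0 \<le> H (t + real N) (\<beta> (t + real N))" by (rule H_nonneg) simp
        show ?case
        proof (cases "b ?k \<le> S ?k \<omega>")
          case True
          have "u ?k (S ?k \<omega>) \<le> g ?k (S ?k \<omega>)"
            unfolding u_def g_def using True le by (intro H_le) (auto simp: b_def)
          moreover have "0 \<le> ?e \<omega>" using H0 t by simp
          ultimately show ?thesis by linarith
        next
          case False
          then have k: "?k = N" using hit_stopped[of N b \<omega>] hit_le[of b N \<omega>] by simp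
          have "u N (S N \<omega>) \<le> H (t + real N) (\<beta> (t + real N))"
            unfolding u_def using le k by (intro H_mono) auto
          moreover have "0 \<le> g N (S N \<omega>) + (\<bar>x\<bar> + \<bar>S N \<omega>\<bar>) / (t + real N)"
          proof -
            have "0 \<le> (x + S N \<omega> + (\<bar>x\<bar> + \<bar>S N \<omega>\<bar>)) / (t + real N)"
              using t by (intro divide_nonneg_pos) linarith+
            then show ?thesis by (simp add: g_def add_divide_distrib)
          qed
          ultimately show ?thesis using k by simp
        qed
      qed
    qed (use ie ig in auto)
    also have "\<dots> = expectation (\<lambda>\<omega>. g (hit b N \<omega>) (S (hit b N \<omega>) \<omega>)) + expectation ?e"
      by (rule Bochner_Integration.integral_add[OF ig ie])
    also have "expectation (\<lambda>\<omega>. g (hit b N \<omega>) (S (hit b N \<omega>) \<omega>)) \<le> value_fun M X t x"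
      using value_fun_upper[OF t hit_stopping_time[of b N], of x] by (simp add: g_def)
    also have "expectation ?e
        = H (t + real N) (\<beta> (t + real N)) + (\<bar>x\<bar> + expectation (\<lambda>\<omega>. \<bar>S N \<omega>\<bar>)) / (t + real N)"
      by (simp add: integrable_abs_S prob_space)
    also have "\<dots> \<le> r N"
      unfolding r_def using t expectation_abs_S[of N] by (intro add_left_mono divide_right_mono) auto
    finally show ?thesis by simp
  qed
  have "(\<lambda>N. (\<bar>x\<bar> + sqrt (real N)) / (t + real N)) \<longlonglongrightarrow> 0"
    by real_asymp
  then have "r \<longlonglongrightarrow> 0"
    unfolding r_def[abs_def] using tendsto_add[OF H_lim] by fastforce
  then have "(\<lambda>N. value_fun M X t x + r N) \<longlonglongrightarrow> value_fun M X t x"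
    using tendsto_add[OF tendsto_const] by fastforce
  then show ?thesis
    by (rule LIMSEQ_le_const) (use main in blast)
qed

end

section \<open>The lower bound for the value function\<close>

theorem theorem2:
  fixes M :: "'a measure" and X :: "nat \<Rightarrow> 'a \<Rightarrow> real"
    and T c1 c2 c a0 t x :: real
  assumes "prob_space M"
    and "symmetric_bernoulli_steps M X"
    and "T > 0"
    and "0 < c1" and "c1 < 1"
    and "1 / 2 * (h c1 (T + 1) (alpha * sqrt T - 1) + h c1 (T + 1) (alpha * sqrt T + 1))
           = h c1 T (alpha * sqrt T)"
    and "\<And>c'. 0 < c' \<Longrightarrow> c' < 1 \<Longrightarrow>
           1 / 2 * (h c' (T + 1) (alpha * sqrt T - 1) + h c' (T + 1) (alpha * sqrt T + 1))
             = h c' T (alpha * sqrt T) \<Longrightarrow> c' \<le> c1"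
    and "0 < c2"
    and "h c2 T (alpha * sqrt T - 1) = (alpha * sqrt T - 1) / T"
    and "c = min c1 c2"
    and "0 < a0"
    and "1 / 2 * (exp a0 + exp (- a0)) * exp (- (c / 2) * a0\<^sup>2) = 1"
    and "T \<ge> (alpha / (a0 * c))\<^sup>2"
    and "t \<ge> T"
    and "x \<le> alpha * sqrt t"
  shows "h c t x \<le> value_fun M X t x"
proof -
  interpret bernoulli_walk M X
    using assms(1,2) by (simp add: bernoulli_walk_def bernoulli_walk_axioms_def)
  have c: "0 < c" "c \<le> c1" "c \<le> c2" and t: "t > 0"
    using assms by auto
  have a0: "cosh a0 * exp (- c / 2 * a0\<^sup>2) = 1"
    using assms(12) by (simp add: cosh_field_def)
  have T: "alpha / (a0 * c) \<le> sqrt T"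
    using assms(13) by (rule real_le_rsqrt)
  have D: "drift c T (alpha * sqrt T) \<ge> 0"
    using drift_at_boundary_nonneg[OF c(1,2) assms(3)] assms(6) by (simp add: drift_def)
  \<comment> \<open>On the boundary \<open>h c\<close> equals the payoff
    \<open>alpha / sqrt s\<close>, so the truncation error vanishes in the limit.\<close>
  have "(\<lambda>n. alpha / sqrt (t + real n)) \<longlonglongrightarrow> 0"
    by real_asymp
  then have lim: "(\<lambda>n. h c (t + real n) (alpha * sqrt (t + real n))) \<longlonglongrightarrow> 0"
    using h_boundary[OF c(1)] t by simp
  show ?thesis
  proof (rule value_fun_lower_bound[where H = "h c" and \<beta> = "\<lambda>s. alpha * sqrt s", OF t assms(15)])
    fix s y assume s: "t \<le> s" and y: "y \<le> alpha * sqrt s - 1"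
    have "drift c s y \<ge> 0"
      by (rule drift_nonneg_later[OF c(1) assms(3) _ _ _ assms(11) a0 T D])
         (use s y assms(14) alpha_bounds in auto)
    then show "h c s y \<le> 1 / 2 * (h c (s + 1) (y - 1) + h c (s + 1) (y + 1))"
      by (simp add: drift_def)
  next
    fix s y assume "t \<le> s" "alpha * sqrt s - 1 \<le> y" "y \<le> alpha * sqrt s"
    then show "h c s y \<le> y / s"
      using assms(14) by (intro h_le_payoff[OF c(1,3) assms(3) _ assms(9)]) auto
  next
    fix s y z :: real assume "t \<le> s" "y \<le> z"
    then show "h c s y \<le> h c s z" using t by (intro h_mono[OF c(1)]) auto
  next
    fix s y :: real assume "t \<le> s"
    then show "0 \<le> h c s y" using t h_pos[OF c(1), of s y] by simp
  qed (use lim t alpha_bounds in \<open>auto intro: mult_left_mono\<close>)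
qed

end
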